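(* Let $N\ge3$ and let $\Omega\subset\mathbb{R}^N$ be a smooth bounded domain containing the origin. Then there is a positive constant $K_3$, independent of $\epsilon$, such that for every $u\in C_0^\infty(\Omega\setminus\{0\})$ with $u\ge0$ and every $\epsilon>0$, $$\int_\Omega u^2\log\Big(\frac{u}{\|u\|_2\,|x|^{\frac{2-N}{2}}d(x)}\Big)dx\ \le\ \epsilon\int_\Omega\Big(|\nabla u|^2-\frac{(N-2)^2}{4|x|^2}u^2\Big)dx+\Big(K_3-\frac{N+2}{4}\log\epsilon\Big)\|u\|_2^2,$$ where $\|u\|_2=(\int_\Omega u^2dx)^{1/2}$.
   Context: "Smooth" domain means of class $C^2$. $d(x)=\mathrm{dist}(x,\partial\Omega)$. The integrand on the left is taken to be $0$ where $u=0$ (and $u\not\equiv0$). *)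

theory Defs
  imports "HOL-Analysis.Analysis"
begin

primrec C_k :: "nat \<Rightarrow> ('a::real_normed_vector \<Rightarrow> 'b::real_normed_vector) \<Rightarrow> bool" where
  "C_k 0 f \<longleftrightarrow> continuous_on UNIV f"
| "C_k (Suc k) f \<longleftrightarrow>
     (\<forall>x. f differentiable at x) \<and> (\<forall>v. C_k k (\<lambda>x. frechet_derivative f (at x) v))"

(* C_c^infinity(U): functions on U are identified with their extension by zero to the
   whole space, so the support is a closed set of the whole space, contained in U. *)
definition test_function :: "('a::euclidean_space \<Rightarrow> real) \<Rightarrow> 'a set \<Rightarrow> bool" where
  "test_function u U \<longleftrightarrow>
     (\<forall>k. C_k k u) \<and> compact (closure {x. u x \<noteq> 0}) \<and> closure {x. u x \<noteq> 0} \<subseteq> U"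

(* Near each boundary point the set is the region strictly above the graph of a C^2 function
   over a hyperplane, in rotated coordinates: the unit vector e is the vertical axis,
   x \<bullet> e the vertical coordinate and x - (x \<bullet> e) *\<^sub>R e the horizontal part of x.
   Only the restriction of \<gamma> to the hyperplane orthogonal to e matters; a C^2 function on that
   hyperplane extends to the whole space by composition with the orthogonal projection. *)
definition C2_boundary :: "'a::euclidean_space set \<Rightarrow> bool" where
  "C2_boundary \<Omega> \<longleftrightarrow>
     (\<forall>p\<in>frontier \<Omega>. \<exists>r>0. \<exists>e. \<exists>\<gamma>::'a \<Rightarrow> real.
        norm e = 1 \<and> C_k 2 \<gamma> \<and>
        \<Omega> \<inter> ball p r = {x \<in> ball p r. x \<bullet> e > \<gamma> (x - (x \<bullet> e) *\<^sub>R e)})"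

definition smooth_bounded_domain :: "'a::euclidean_space set \<Rightarrow> bool" where
  "smooth_bounded_domain \<Omega> \<longleftrightarrow>
     open \<Omega> \<and> connected \<Omega> \<and> \<Omega> \<noteq> {} \<and> bounded \<Omega> \<and> C2_boundary \<Omega>"

definition grad :: "('a::euclidean_space \<Rightarrow> real) \<Rightarrow> 'a \<Rightarrow> 'a" where
  "grad u x = (THE D. GDERIV u x :> D)"

definition L2_norm_on :: "'a::euclidean_space set \<Rightarrow> ('a \<Rightarrow> real) \<Rightarrow> real" where
  "L2_norm_on \<Omega> u = sqrt (LINT x:\<Omega>|lborel. (u x)\<^sup>2)"

lemma grad_eqI:
  assumes "GDERIV u x :> D"
  shows "grad u x = D"
  unfolding grad_def
proof (rule the_equality)
  show "GDERIV u x :> D" by (fact assms)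
next
  fix E assume "GDERIV u x :> E"
  with assms have "(\<lambda>h. inner h E) = (\<lambda>h. inner h D)"
    unfolding gderiv_def by (blast intro: has_derivative_unique)
  then show "E = D"
    by (metis euclidean_eqI inner_commute)
qed

end

theory Submission
  imports Defs
begin

text \<open>
  Write \<open>N\<close> for the dimension, \<open>\<beta> = (N - 2) / 2\<close>, \<open>d\<close> for the distance to the boundary and \<open>Q(u)\<close> for
  the Hardy form. With \<open>\<integral> u\<^sup>2 = 1\<close> the logarithm splits into \<open>ln (u |x|\<^sup>\<beta>)\<close> and \<open>- ln d\<close>, and each part is
  bounded at a free scale \<open>s\<close> with \<open>s\<^sup>2\<close> proportional to \<open>\<epsilon>\<close>.

  \<^item> From \<open>- 2 ln d \<le> s\<^sup>2 / d\<^sup>2 - 1 - 2 ln s\<close> and the Hardy inequality \<open>\<integral> u\<^sup>2 / d\<^sup>2 \<le> C Q(u)\<close>, the second part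
    contributes \<open>- ln s\<close>.

  \<^item> Completing the square with the radial field \<open>(\<beta> |x|\<^sup>-\<^sup>2 + c |x|\<^sup>\<alpha>\<^sup>-\<^sup>2) x\<close> bounds
    \<open>\<integral> |x|\<^sup>\<alpha> |\<nabla>u|\<^sup>2 + |x|\<^sup>\<alpha>\<^sup>-\<^sup>2 u\<^sup>2\<close> by \<open>C Q(u)\<close> for every \<open>\<alpha> > 0\<close>. Hence \<open>v = |x|\<^sup>\<gamma> u\<close> lies in \<open>H\<^sup>1\<close> for every \<open>\<gamma> > 0\<close>,
    and comparing \<open>v\<close> with its translates over balls of radii \<open>s q\<^sup>-\<^sup>k\<close> estimates \<open>\<integral> v\<^sup>2\<^sup>+\<^sup>\<delta>\<close> for \<open>\<delta> = 2 / N\<close> by summing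
    over dyadic superlevel sets. For a suitable \<open>\<gamma>\<close> this controls the first part, with \<open>- (N / 2) ln s\<close>.

  Together this gives \<open>- ((N + 2) / 2) ln s\<close>, that is \<open>- ((N + 2) / 4) ln \<epsilon>\<close> up to a constant.
\<close>

section \<open>Compactly supported C1 functions and integration by parts\<close>

text \<open>The gradient \<open>u'\<close> is carried as an explicit function, so that no uniqueness
  argument is needed inside integrals. \<open>K\<close> is any compact set off which
  \<open>u\<close> vanishes rather than the support itself, so the same \<open>K\<close> serves for
  products and powers and may be shrunk after multiplying by a cutoff.\<close>

definition C1_supp :: "('a::euclidean_space \<Rightarrow> real) \<Rightarrow> ('a \<Rightarrow> 'a) \<Rightarrow> 'a set \<Rightarrow> bool" where
  "C1_supp u u' K \<longleftrightarrow> compact K \<and> (\<forall>x. GDERIV u x :> u' x) \<and> continuous_on UNIV u' \<and>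
     (\<forall>x. x \<notin> K \<longrightarrow> u x = 0)"

lemma GDERIV_continuous_on:
  assumes "\<And>x. x \<in> S \<Longrightarrow> GDERIV f x :> f' x"
  shows "continuous_on S f"
  using assms unfolding gderiv_def
  by (meson continuous_at_imp_continuous_on has_derivative_continuous)

lemma GDERIV_zero_on_open:
  assumes "open S" "x \<in> S" "\<And>y. y \<in> S \<Longrightarrow> f y = (0::real)"
  shows "GDERIV f x :> 0"
proof -
  have "((\<lambda>_. 0) has_derivative (\<lambda>h. h \<bullet> 0)) (at x)"
    by simp
  then show ?thesis
    unfolding gderiv_def
    by (rule has_derivative_transform_within_open[OF _ assms(1,2)]) (simp add: assms(3))
qed

lemma C1_suppD:
  assumes "C1_supp u u' K"
  shows "compact K" "GDERIV u x :> u' x" "continuous_on S u'" "x \<notin> K \<Longrightarrow> u x = 0"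
    "continuous_on S u" "x \<notin> K \<Longrightarrow> u' x = 0"
proof -
  show *: "compact K" "GDERIV u x :> u' x" "x \<notin> K \<Longrightarrow> u x = 0" for x
    using assms by (auto simp: C1_supp_def)
  show "continuous_on S u'"
    using assms by (auto simp: C1_supp_def intro: continuous_on_subset)
  show "continuous_on S u"
    using * by (blast intro: GDERIV_continuous_on)
  assume x: "x \<notin> K"
  have "open (- K)"
    using * by (simp add: compact_imp_closed open_Compl)
  then have "GDERIV u x :> 0"
    using x *(3) by (intro GDERIV_zero_on_open) auto
  then show "u' x = 0"
    using *(2)[of x] by (metis grad_eqI)
qed

lemma integrable_compact_support:
  fixes f :: "'a::euclidean_space \<Rightarrow> real"
  assumes "compact K" "continuous_on K f" "\<And>x. x \<notin> K \<Longrightarrow> f x = 0"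
  shows "integrable lborel f"
proof -
  have "(\<lambda>x. indicator K x *\<^sub>R f x) = f"
    using assms(3) by (auto simp: indicator_def fun_eq_iff)
  then show ?thesis
    using borel_integrable_compact[OF assms(1,2)] by simp
qed

lemma lborel_integral_translate:
  fixes f :: "'a::euclidean_space \<Rightarrow> real"
  assumes "f \<in> borel_measurable borel"
  shows "(LINT x|lborel. f (c + x)) = (LINT x|lborel. f x)"
  using integral_distr[of "(+) c" lborel borel f] assms
  by (simp add: lborel_distr_plus)

lemma lborel_nn_integral_translate:
  fixes f :: "'a::euclidean_space \<Rightarrow> ennreal"
  assumes "f \<in> borel_measurable borel"
  shows "(\<integral>\<^sup>+x. f (c + x) \<partial>lborel) = (\<integral>\<^sup>+x. f x \<partial>lborel)"
  using nn_integral_distr[of "(+) c" lborel borel f] assms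
  by (simp add: lborel_distr_plus)

lemma GDERIV_line:
  assumes "GDERIV f (x + t *\<^sub>R e) :> D"
  shows "((\<lambda>t. f (x + t *\<^sub>R e)) has_real_derivative (D \<bullet> e)) (at t)"
proof -
  have 1: "((\<lambda>t. x + t *\<^sub>R e) has_derivative (\<lambda>s. s *\<^sub>R e)) (at t)"
    by (auto intro!: derivative_eq_intros)
  have "((\<lambda>t. f (x + t *\<^sub>R e)) has_derivative (\<lambda>s. (s *\<^sub>R e) \<bullet> D)) (at t)"
    using has_derivative_compose[OF 1] assms unfolding gderiv_def by blast
  moreover have "(\<lambda>s. (s *\<^sub>R e) \<bullet> D) = (*) (D \<bullet> e)"
    by (auto simp: inner_commute mult.commute)
  ultimately show ?thesis
    by (simp add: has_field_derivative_def)
qed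

text \<open>The difference quotients of \<open>f\<close> in direction \<open>e\<close> have integral
  0 by translation invariance of Lebesgue measure. They converge pointwise to
  \<open>f' x \<bullet> e\<close>, and dominated convergence carries the value 0 to the
  limit.\<close>

lemma integral_directional_derivative_eq_0:
  assumes "C1_supp f f' K"
  shows "(LINT x|lborel. f' x \<bullet> e) = 0"
proof -
  note C = C1_suppD[OF assms]
  obtain R where R: "\<And>x. x \<in> K \<Longrightarrow> norm x \<le> R"
    using C(1) compact_imp_bounded bounded_iff by metis
  obtain B where B: "\<And>x. norm (f' x) \<le> B"
  proof -
    obtain B where "\<And>x. x \<in> K \<Longrightarrow> norm (f' x) \<le> B"
      using compact_imp_bounded[OF compact_continuous_image[OF C(3) C(1)]]
      unfolding bounded_iff by auto
    then have "norm (f' x) \<le> max B 0" for x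
      using C(6)[of x] by (cases "x \<in> K") (auto simp: le_max_iff_disj)
    then show ?thesis using that by blast
  qed
  have fm: "f \<in> borel_measurable borel"
    using C(5) by (rule borel_measurable_continuous_onI)
  define t where "t n = 1 / real (Suc n)" for n
  have t: "0 < t n" "t n \<le> 1" for n by (auto simp: t_def)
  define g where "g n x = (f (x + t n *\<^sub>R e) - f x) / t n" for n x
  have gm: "g n \<in> borel_measurable borel" for n
    unfolding g_def using C(5)[of UNIV]
    by (intro borel_measurable_continuous_onI continuous_intros continuous_on_compose2[OF C(5)]) (use t[of n] in auto)
  have g0: "(LINT x|lborel. g n x) = 0" for n
  proof -
    have i1: "integrable lborel f"
      using integrable_compact_support C by blast
    have i2: "integrable lborel (\<lambda>x. f (t n *\<^sub>R e + x))"
      using integrable_distr_eq[of "(+) (t n *\<^sub>R e)" lborel borel f] fm i1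
      by (simp add: lborel_distr_plus)
    have "(LINT x|lborel. g n x) = (LINT x|lborel. (f (t n *\<^sub>R e + x) - f x) / t n)"
      by (simp add: g_def add.commute)
    also have "\<dots> = 0"
      using i1 i2 lborel_integral_translate[OF fm, of "t n *\<^sub>R e"] by simp
    finally show ?thesis .
  qed
  have mvt: "\<exists>s. 0 < s \<and> s < t n \<and> g n x = f' (x + s *\<^sub>R e) \<bullet> e" for n x
  proof -
    have "\<exists>z>0. z < t n \<and> f (x + t n *\<^sub>R e) - f (x + 0 *\<^sub>R e) = (t n - 0) * (f' (x + z *\<^sub>R e) \<bullet> e)"
      using MVT2[of 0 "t n" "\<lambda>s. f (x + s *\<^sub>R e)" "\<lambda>s. f' (x + s *\<^sub>R e) \<bullet> e"] GDERIV_line[OF C(2)] t[of n]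
      by blast
    then show ?thesis using t[of n] by (auto simp: g_def field_simps)
  qed
  \<comment> \<open>All shifts have length at most \<open>norm e\<close>, since
    \<open>t n \<le> 1\<close>. Hence the mean value form bounds every quotient by
    \<open>B * norm e\<close>, and every quotient vanishes outside one common ball, which supplies
    the dominating function.\<close>
  have bnd: "norm (g n x) \<le> indicator (cball 0 (R + norm e)) x *\<^sub>R (B * norm e)" for n x
  proof -
    obtain s where s: "0 < s" "s < t n" "g n x = f' (x + s *\<^sub>R e) \<bullet> e" using mvt by blast
    show ?thesis
    proof (cases "norm x \<le> R + norm e")
      case True
      have "\<bar>g n x\<bar> \<le> norm (f' (x + s *\<^sub>R e)) * norm e"
        unfolding s(3) by (rule Cauchy_Schwarz_ineq2)
      also have "\<dots> \<le> B * norm e" using B by (intro mult_right_mono) auto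
      finally show ?thesis using True by simp
    next
      case False
      have "norm (x + s *\<^sub>R e) > R"
      proof -
        have "s * norm e \<le> norm e" using s t[of n] by (simp add: mult_left_le_one_le)
        moreover have "norm x \<le> norm (x + s *\<^sub>R e) + norm (s *\<^sub>R e)"
          by (metis add_diff_cancel_right' norm_triangle_ineq4)
        ultimately show ?thesis using False s by simp
      qed
      then have "f' (x + s *\<^sub>R e) = 0" using R C(6) by force
      then show ?thesis using s False by simp
    qed
  qed
  have lim: "(\<lambda>n. g n x) \<longlonglongrightarrow> f' x \<bullet> e" for x
  proof -
    have "((\<lambda>s. (f (x + s *\<^sub>R e) - f x) / s) \<longlongrightarrow> f' x \<bullet> e) (at 0)"
      using GDERIV_line[of f x 0 e, OF C(2)] by (simp add: DERIV_def)
    moreover have "filterlim t (at 0) sequentially"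
      unfolding filterlim_at using LIMSEQ_inverse_real_of_nat t
      by (auto simp: t_def[abs_def] inverse_eq_divide)
    ultimately show ?thesis
      unfolding g_def by (rule filterlim_compose)
  qed
  have "(\<lambda>n. LINT x|lborel. g n x) \<longlonglongrightarrow> (LINT x|lborel. f' x \<bullet> e)"
  proof (rule integral_dominated_convergence)
    show "(\<lambda>x. f' x \<bullet> e) \<in> borel_measurable lborel"
      using C(3)[of UNIV] by (auto intro!: borel_measurable_continuous_onI continuous_intros)
    show "integrable lborel (\<lambda>x. indicator (cball 0 (R + norm e)) x *\<^sub>R (B * norm e))"
      by (intro borel_integrable_compact) auto
  qed (use gm lim bnd in auto)
  then show ?thesis using g0 by (simp add: LIMSEQ_const_iff)
qed

text \<open>The factor \<open>h\<close> may be singular away from \<open>K\<close>, as are powers of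
  the norm at the origin or the reciprocal of a height function at the boundary. The product is
  differentiable with continuous gradient on \<open>U\<close> and vanishes on the open set
  \<open>- K\<close>, and these two open sets cover the space.\<close>

lemma C1_supp_mult:
  assumes "C1_supp \<phi> \<phi>' K" "open U" "K \<subseteq> U"
    and h: "\<And>x. x \<in> U \<Longrightarrow> GDERIV h x :> h' x" "continuous_on U h'"
  shows "C1_supp (\<lambda>x. \<phi> x * h x) (\<lambda>x. \<phi> x *\<^sub>R h' x + h x *\<^sub>R \<phi>' x) K"
  unfolding C1_supp_def
proof (intro conjI allI impI)
  note C = C1_suppD[OF assms(1)]
  let ?F = "\<lambda>x. \<phi> x *\<^sub>R h' x + h x *\<^sub>R \<phi>' x"
  show "compact K" by fact
  have op: "open (- K)" using C(1) by (simp add: compact_imp_closed open_Compl)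
  have un: "U \<union> - K = UNIV" using assms(3) by auto
  show "GDERIV (\<lambda>x. \<phi> x * h x) x :> ?F x" for x
  proof (cases "x \<in> K")
    case True
    then show ?thesis
      using C(2)[of x] h(1)[of x] assms(3) by (auto intro: GDERIV_mult)
  next
    case False
    then have "?F x = 0" using C by simp
    moreover have "GDERIV (\<lambda>x. \<phi> x * h x) x :> 0"
      using False C(4) op by (intro GDERIV_zero_on_open[of "- K"]) auto
    ultimately show ?thesis by simp
  qed
  have "continuous_on U ?F"
    by (intro continuous_intros C h GDERIV_continuous_on[of U h h'])
  moreover have "continuous_on (- K) ?F"
  proof (rule continuous_on_eq)
    show "continuous_on (- K) (\<lambda>_. 0 :: 'a)" by simp
  qed (simp add: C)
  ultimately show "continuous_on UNIV ?F"
    using continuous_on_open_Un[OF assms(2) op] un by metis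
  show "\<phi> x * h x = 0" if "x \<notin> K" for x using that C by simp
qed

lemma integration_by_parts:
  assumes "C1_supp \<phi> \<phi>' K" "open U" "K \<subseteq> U"
    and h: "\<And>x. x \<in> U \<Longrightarrow> GDERIV h x :> h' x" "continuous_on U h'"
  shows "(LINT x|lborel. \<phi> x * (h' x \<bullet> e) + h x * (\<phi>' x \<bullet> e)) = 0"
  using integral_directional_derivative_eq_0[OF C1_supp_mult[OF assms], of e]
  by (simp add: inner_add_left)

lemma C1_supp_power2:
  assumes "C1_supp u u' K"
  shows "C1_supp (\<lambda>x. (u x)\<^sup>2) (\<lambda>x. (2 * u x) *\<^sub>R u' x) K"
proof -
  note C = C1_suppD[OF assms]
  have "C1_supp (\<lambda>x. u x * u x) (\<lambda>x. u x *\<^sub>R u' x + u x *\<^sub>R u' x) K"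
    using C1_supp_mult[OF assms open_UNIV subset_UNIV C(2) C(3)] .
  then show ?thesis
    by (simp add: power2_eq_square scaleR_2 flip: scaleR_add_left mult_2)
qed

lemma GDERIV_norm_powr:
  fixes x :: "'a::euclidean_space"
  assumes "x \<noteq> 0"
  shows "GDERIV (\<lambda>x. norm x powr p) x :> (p * norm x powr (p - 2)) *\<^sub>R x"
proof -
  have "DERIV (\<lambda>r. r powr p) (norm x) :> p * norm x powr (p - 1)"
    using assms by (intro has_real_derivative_powr) auto
  from GDERIV_DERIV_compose[OF GDERIV_norm[OF assms] this] show ?thesis
  proof (rule GDERIV_subst)
    have "norm x powr (p - 2) = norm x powr (p - 1) / norm x"
      using assms powr_diff[of "norm x" "p - 1" 1] by (simp add: powr_one)
    then show "(p * norm x powr (p - 1)) *\<^sub>R sgn x = (p * norm x powr (p - 2)) *\<^sub>R x"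
      by (simp add: sgn_div_norm divide_inverse mult.assoc)
  qed
qed

section \<open>Weighted Hardy inequalities at the origin\<close>

text \<open>The integral extends over the whole space because the functions in question vanish
  outside the domain. At the origin the potential has the value 0 by the convention for division; if
  \<open>0 \<notin> K\<close>, the function vanishes near that point anyway.\<close>

definition hardy_form :: "('a::euclidean_space \<Rightarrow> real) \<Rightarrow> ('a \<Rightarrow> 'a) \<Rightarrow> real" where
  "hardy_form u u' =
     (LINT x|lborel. (norm (u' x))\<^sup>2 - (real DIM('a) - 2)\<^sup>2 / (4 * (norm x)\<^sup>2) * (u x)\<^sup>2)"

text \<open>This is the divergence theorem for the field \<open>(u x)^2 * g x\<close> times
  \<open>x\<close>, which has compact support away from 0. Its coordinates are integrated by parts
  one at a time, and the sum over \<open>Basis\<close> produces the factor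
  \<open>DIM('a)\<close>.\<close>

lemma radial_field_identity:
  fixes u :: "'a::euclidean_space \<Rightarrow> real"
  assumes u: "C1_supp u u' K" "0 \<notin> K"
    and g: "\<And>x. x \<noteq> 0 \<Longrightarrow> GDERIV g x :> g' x" "continuous_on (- {0}) g'"
  shows "(LINT x|lborel. (real DIM('a) * g x + g' x \<bullet> x) * (u x)\<^sup>2 + 2 * g x * u x * (u' x \<bullet> x)) = 0"
proof -
  note C = C1_suppD[OF u(1)]
  have K: "K \<subseteq> - {0}" using u by auto
  have cg: "continuous_on K g" "continuous_on K g'"
    using g K GDERIV_continuous_on[of "- {0}" g g'] by (auto intro: continuous_on_subset)
  have *: "(LINT x|lborel. (u x)\<^sup>2 * ((g x *\<^sub>R b + (x \<bullet> b) *\<^sub>R g' x) \<bullet> b) + (g x * (x \<bullet> b)) * (((2 * u x) *\<^sub>R u' x) \<bullet> b)) = 0"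
    for b :: 'a
  proof (rule integration_by_parts[OF C1_supp_power2[OF u(1)] _ K])
    fix x :: 'a assume "x \<in> - {0}"
    then have "GDERIV g x :> g' x" using g by simp
    moreover have "GDERIV (\<lambda>x. x \<bullet> b) x :> b"
      unfolding gderiv_def by (auto intro!: derivative_eq_intros)
    ultimately show "GDERIV (\<lambda>x. g x * (x \<bullet> b)) x :> g x *\<^sub>R b + (x \<bullet> b) *\<^sub>R g' x"
      by (rule GDERIV_mult)
  qed (use g in \<open>auto intro!: continuous_intros GDERIV_continuous_on[of _ g g']\<close>)
  have int: "integrable lborel (\<lambda>x. (u x)\<^sup>2 * ((g x *\<^sub>R b + (x \<bullet> b) *\<^sub>R g' x) \<bullet> b) + (g x * (x \<bullet> b)) * (((2 * u x) *\<^sub>R u' x) \<bullet> b))"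
    for b :: 'a
    by (rule integrable_compact_support[OF C(1)]) (use C cg in \<open>auto intro!: continuous_intros\<close>)
  have "(\<Sum>b\<in>Basis. (u x)\<^sup>2 * ((g x *\<^sub>R b + (x \<bullet> b) *\<^sub>R g' x) \<bullet> b) + (g x * (x \<bullet> b)) * (((2 * u x) *\<^sub>R u' x) \<bullet> b))
      = (real DIM('a) * g x + g' x \<bullet> x) * (u x)\<^sup>2 + 2 * g x * u x * (u' x \<bullet> x)" for x
  proof -
    have "(\<Sum>b\<in>Basis. (u x)\<^sup>2 * ((g x *\<^sub>R b + (x \<bullet> b) *\<^sub>R g' x) \<bullet> b) + (g x * (x \<bullet> b)) * (((2 * u x) *\<^sub>R u' x) \<bullet> b))
      = (\<Sum>b\<in>Basis. (u x)\<^sup>2 * g x + (u x)\<^sup>2 * ((g' x \<bullet> b) * (x \<bullet> b)) + 2 * g x * u x * ((u' x \<bullet> b) * (x \<bullet> b)))"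
      by (intro sum.cong) (auto simp: inner_add_left algebra_simps)
    also have "\<dots> = real DIM('a) * ((u x)\<^sup>2 * g x) + (u x)\<^sup>2 * (g' x \<bullet> x) + 2 * g x * u x * (u' x \<bullet> x)"
      by (simp only: sum.distrib sum_distrib_left[symmetric] sum_constant euclidean_inner[of _ x, symmetric])
         (simp add: algebra_simps)
    finally show ?thesis by (simp add: algebra_simps)
  qed
  then show ?thesis
    using Bochner_Integration.integral_sum[of Basis lborel "\<lambda>b x. (u x)\<^sup>2 * ((g x *\<^sub>R b + (x \<bullet> b) *\<^sub>R g' x) \<bullet> b) + (g x * (x \<bullet> b)) * (((2 * u x) *\<^sub>R u' x) \<bullet> b)", OF int] *
    by (simp del: inner_scaleR_left)
qed

text \<open>Expanding the square leaves the mixed term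
  \<open>2 * g x * u x * (u' x \<bullet> x)\<close>, which the divergence identity trades for a
  multiple of \<open>(u x)^2\<close>. Thus each radial \<open>g\<close> yields a potential dominated
  by the Dirichlet integral.\<close>

lemma radial_square_expansion:
  fixes u :: "'a::euclidean_space \<Rightarrow> real"
  assumes u: "C1_supp u u' K" "0 \<notin> K"
    and g: "\<And>x. x \<noteq> 0 \<Longrightarrow> GDERIV g x :> g' x" "continuous_on (- {0}) g'"
  shows "(LINT x|lborel. (norm (u' x + (g x * u x) *\<^sub>R x))\<^sup>2)
    = (LINT x|lborel. (norm (u' x))\<^sup>2 - (real DIM('a) * g x + g' x \<bullet> x - (g x)\<^sup>2 * (norm x)\<^sup>2) * (u x)\<^sup>2)"
proof -
  note C = C1_suppD[OF u(1)]
  have K: "K \<subseteq> - {0}" using u by auto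
  have cg: "continuous_on K g" "continuous_on K g'"
    using g K GDERIV_continuous_on[of "- {0}" g g'] by (auto intro: continuous_on_subset)
  have sq: "(norm (a + s *\<^sub>R x))\<^sup>2 = (norm a)\<^sup>2 + 2 * s * (a \<bullet> x) + s\<^sup>2 * (norm x)\<^sup>2" for a x :: 'a and s
    by (simp add: power2_norm_eq_inner inner_add_left inner_add_right inner_commute)
       (simp add: power2_eq_square)
  have "(LINT x|lborel. (norm (u' x + (g x * u x) *\<^sub>R x))\<^sup>2)
     = (LINT x|lborel. ((norm (u' x))\<^sup>2 - (real DIM('a) * g x + g' x \<bullet> x - (g x)\<^sup>2 * (norm x)\<^sup>2) * (u x)\<^sup>2)
         + ((real DIM('a) * g x + g' x \<bullet> x) * (u x)\<^sup>2 + 2 * g x * u x * (u' x \<bullet> x)))"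
    by (intro Bochner_Integration.integral_cong refl)
       (simp add: sq power_mult_distrib algebra_simps)
  also have "\<dots> = (LINT x|lborel. (norm (u' x))\<^sup>2 - (real DIM('a) * g x + g' x \<bullet> x - (g x)\<^sup>2 * (norm x)\<^sup>2) * (u x)\<^sup>2)
        + (LINT x|lborel. (real DIM('a) * g x + g' x \<bullet> x) * (u x)\<^sup>2 + 2 * g x * u x * (u' x \<bullet> x))"
    by (intro Bochner_Integration.integral_add integrable_compact_support[OF C(1)])
       (use C cg in \<open>auto intro!: continuous_intros\<close>)
  finally show ?thesis using radial_field_identity[OF assms] by simp
qed

lemma norm_powr_mult_norm_square:
  fixes x :: "'a::euclidean_space"
  assumes "x \<noteq> 0"
  shows "norm x powr p * (norm x)\<^sup>2 = norm x powr (p + 2)"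
  using assms by (simp add: powr_add flip: powr_numeral)

text \<open>The field with coefficient \<open>\<beta> * norm x powr (-2)\<close> produces exactly
  the Hardy potential, as \<beta>^2 = (N-2)^2/4. When the term with \<open>c\<close> is added, the
  products of \<beta> and \<open>c\<close> cancel because N = 2 \<beta> + 2, and only terms of order
  \<open>c\<close> and \<open>c^2\<close> remain.\<close>

lemma hardy_form_eq:
  fixes u :: "'a::euclidean_space \<Rightarrow> real"
  assumes u: "C1_supp u u' K" "0 \<notin> K" and \<beta>: "\<beta> = (real DIM('a) - 2) / 2"
  shows "hardy_form u u' = (LINT x|lborel. (norm (u' x + (\<beta> * norm x powr (-2) * u x) *\<^sub>R x))\<^sup>2)"
    and "hardy_form u u' = (LINT x|lborel. (norm (u' x + ((\<beta> * norm x powr (-2) + c * norm x powr (\<alpha> - 2)) * u x) *\<^sub>R x))\<^sup>2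
      + (c * \<alpha> * norm x powr (\<alpha> - 2) - c\<^sup>2 * norm x powr (2 * \<alpha> - 2)) * (u x)\<^sup>2)"
proof -
  note C = C1_suppD[OF u(1)]
  define g where "g c x = \<beta> * norm x powr (-2) + c * norm x powr (\<alpha> - 2)" for c and x :: 'a
  define g' where "g' c x = (\<beta> * (-2 * norm x powr (-4)) + c * ((\<alpha> - 2) * norm x powr (\<alpha> - 4))) *\<^sub>R x"
    for c and x :: 'a
  have g: "GDERIV (g c) x :> g' c x" if "x \<noteq> 0" for c x
  proof -
    have "GDERIV (g c) x :> (\<beta> *\<^sub>R ((-2 * norm x powr (-2 - 2)) *\<^sub>R x) + (norm x powr -2) *\<^sub>R 0)
         + (c *\<^sub>R (((\<alpha> - 2) * norm x powr (\<alpha> - 2 - 2)) *\<^sub>R x) + (norm x powr (\<alpha> - 2)) *\<^sub>R 0)"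
      unfolding g_def by (intro GDERIV_add GDERIV_mult GDERIV_norm_powr GDERIV_const that)
    then show ?thesis by (rule GDERIV_subst) (simp add: g'_def algebra_simps)
  qed
  have cg: "continuous_on (- {0}) (g' c)" for c
    unfolding g'_def by (intro continuous_intros) auto
  have dv: "real DIM('a) * g c x + g' c x \<bullet> x - (g c x)\<^sup>2 * (norm x)\<^sup>2
      = (real DIM('a) - 2)\<^sup>2 / (4 * (norm x)\<^sup>2) + (c * \<alpha> * norm x powr (\<alpha> - 2) - c\<^sup>2 * norm x powr (2 * \<alpha> - 2))"
    if "x \<noteq> 0" for x c
  proof -
    define r where "r = norm x"
    have r: "r > 0" using that by (simp add: r_def)
    define A where "A = r powr (\<alpha> - 2)"
    have p1: "r powr (-2) = 1 / r\<^sup>2" "r powr (-4) = 1 / r^4"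
      using r by (simp_all add: powr_minus_divide flip: powr_numeral)
    have p2: "r powr (\<alpha> - 4) = A / r\<^sup>2"
      using r powr_diff[of r "\<alpha> - 2" 2] by (simp add: A_def)
    have p3: "r powr (2 * \<alpha> - 2) = A\<^sup>2 * r\<^sup>2"
      using r powr_add[of r "(\<alpha> - 2) + (\<alpha> - 2)" 2] powr_add[of r "\<alpha> - 2" "\<alpha> - 2"]
      by (simp add: A_def power2_eq_square algebra_simps)
    have ii: "x \<bullet> x = r\<^sup>2" by (simp add: r_def power2_norm_eq_inner)
    have "real DIM('a) * g c x + g' c x \<bullet> x - (g c x)\<^sup>2 * (norm x)\<^sup>2
      = real DIM('a) * (\<beta> * (1 / r\<^sup>2) + c * A) + (\<beta> * (-2 * (1 / r^4)) + c * ((\<alpha> - 2) * (A / r\<^sup>2))) * r\<^sup>2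
         - (\<beta> * (1 / r\<^sup>2) + c * A)\<^sup>2 * r\<^sup>2"
      using p1 p2 by (simp add: g_def g'_def ii flip: r_def A_def)
    also have "\<dots> = (2 * \<beta> + 2) * (\<beta> / r\<^sup>2 + c * A) - 2 * \<beta> / r\<^sup>2 + c * (\<alpha> - 2) * A
         - (\<beta>\<^sup>2 / r\<^sup>2 + 2 * \<beta> * c * A + c\<^sup>2 * (A\<^sup>2 * r\<^sup>2))"
      using r \<beta> by (simp add: field_simps power2_eq_square power4_eq_xxxx)
    also have "\<dots> = \<beta>\<^sup>2 / r\<^sup>2 + (c * \<alpha> * A - c\<^sup>2 * (A\<^sup>2 * r\<^sup>2))"
      using r by (simp add: field_simps power2_eq_square)
    finally show ?thesis
      unfolding r_def[symmetric] p3 A_def[symmetric] by (simp add: \<beta> power_divide)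
  qed
  have eq: "(LINT x|lborel. (norm (u' x + (g c x * u x) *\<^sub>R x))\<^sup>2)
    = (LINT x|lborel. (norm (u' x))\<^sup>2 - ((real DIM('a) - 2)\<^sup>2 / (4 * (norm x)\<^sup>2) + (c * \<alpha> * norm x powr (\<alpha> - 2) - c\<^sup>2 * norm x powr (2 * \<alpha> - 2))) * (u x)\<^sup>2)"
    for c
  proof (subst radial_square_expansion[OF u, of "g c" "g' c"], fact g, fact cg, rule Bochner_Integration.integral_cong[OF refl])
    fix x :: 'a
    \<comment> \<open>The pointwise identity \<open>dv\<close> is available only for
      \<open>x \<noteq> 0\<close>; at the origin both sides agree because \<open>u\<close> vanishes
      there.\<close>
    show "(norm (u' x))\<^sup>2 - (real DIM('a) * g c x + g' c x \<bullet> x - (g c x)\<^sup>2 * (norm x)\<^sup>2) * (u x)\<^sup>2 =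
      (norm (u' x))\<^sup>2 - ((real DIM('a) - 2)\<^sup>2 / (4 * (norm x)\<^sup>2) + (c * \<alpha> * norm x powr (\<alpha> - 2) - c\<^sup>2 * norm x powr (2 * \<alpha> - 2))) * (u x)\<^sup>2"
      using dv[of x c] C(4)[of x] u(2) by (cases "x = 0") simp_all
  qed
  show "hardy_form u u' = (LINT x|lborel. (norm (u' x + (\<beta> * norm x powr (-2) * u x) *\<^sub>R x))\<^sup>2)"
    using eq[of 0] by (simp add: hardy_form_def g_def)
  have "(LINT x|lborel. (norm (u' x + (g c x * u x) *\<^sub>R x))\<^sup>2 + (c * \<alpha> * norm x powr (\<alpha> - 2) - c\<^sup>2 * norm x powr (2 * \<alpha> - 2)) * (u x)\<^sup>2)
     = (LINT x|lborel. (norm (u' x + (g c x * u x) *\<^sub>R x))\<^sup>2) + (LINT x|lborel. (c * \<alpha> * norm x powr (\<alpha> - 2) - c\<^sup>2 * norm x powr (2 * \<alpha> - 2)) * (u x)\<^sup>2)"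
    by (intro Bochner_Integration.integral_add integrable_compact_support[OF C(1)])
       (use C u(2) in \<open>auto simp: g_def intro!: continuous_intros\<close>)
  also have "\<dots> = (LINT x|lborel. ((norm (u' x))\<^sup>2 - ((real DIM('a) - 2)\<^sup>2 / (4 * (norm x)\<^sup>2) + (c * \<alpha> * norm x powr (\<alpha> - 2) - c\<^sup>2 * norm x powr (2 * \<alpha> - 2))) * (u x)\<^sup>2)
     + (c * \<alpha> * norm x powr (\<alpha> - 2) - c\<^sup>2 * norm x powr (2 * \<alpha> - 2)) * (u x)\<^sup>2)"
    unfolding eq
    by (intro Bochner_Integration.integral_add[symmetric] integrable_compact_support[OF C(1)])
       (use C u(2) in \<open>auto intro!: continuous_intros\<close>)
  also have "\<dots> = hardy_form u u'"
    unfolding hardy_form_def by (intro Bochner_Integration.integral_cong refl) (simp add: algebra_simps)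
  finally show "hardy_form u u' = (LINT x|lborel. (norm (u' x + ((\<beta> * norm x powr (-2) + c * norm x powr (\<alpha> - 2)) * u x) *\<^sub>R x))\<^sup>2
      + (c * \<alpha> * norm x powr (\<alpha> - 2) - c\<^sup>2 * norm x powr (2 * \<alpha> - 2)) * (u x)\<^sup>2)"
    by (simp add: g_def)
qed

text \<open>In the second form of \<open>hardy_form_eq\<close> the square is dropped. On the ball of
  radius \<open>R\<close> half of the term linear in \<open>c\<close> absorbs the quadratic one,
  which leaves a positive multiple of the weighted integral.\<close>

lemma weighted_hardy_L2:
  fixes u :: "'a::euclidean_space \<Rightarrow> real"
  assumes u: "C1_supp u u' K" "0 \<notin> K" and K: "K \<subseteq> cball 0 R" and "R > 0" "\<alpha> > 0"
  shows "(LINT x|lborel. norm x powr (\<alpha> - 2) * (u x)\<^sup>2) \<le> 4 * R powr \<alpha> / \<alpha>\<^sup>2 * hardy_form u u'"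
proof -
  note C = C1_suppD[OF u(1)]
  \<comment> \<open>This value maximises \<open>c * (\<alpha> - c * R powr \<alpha>)\<close>, the
    worst coefficient of \<open>norm x powr (\<alpha> - 2)\<close> on the ball.\<close>
  define c where "c = \<alpha> / (2 * R powr \<alpha>)"
  have Ra: "R powr \<alpha> > 0" using assms by simp
  have c: "c > 0" "c * R powr \<alpha> = \<alpha> / 2" using assms Ra by (simp_all add: c_def)
  define \<beta> where "\<beta> = (real DIM('a) - 2) / 2"
  have "(LINT x|lborel. c * \<alpha> / 2 * (norm x powr (\<alpha> - 2) * (u x)\<^sup>2)) \<le> hardy_form u u'"
    unfolding hardy_form_eq(2)[OF u \<beta>_def, of c \<alpha>]
  proof (rule integral_mono)
    show "integrable lborel (\<lambda>x. c * \<alpha> / 2 * (norm x powr (\<alpha> - 2) * (u x)\<^sup>2))"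
      by (rule integrable_compact_support[OF C(1)])
         (use C u(2) in \<open>auto intro!: continuous_intros\<close>)
    show "integrable lborel (\<lambda>x. (norm (u' x + ((\<beta> * norm x powr (-2) + c * norm x powr (\<alpha> - 2)) * u x) *\<^sub>R x))\<^sup>2
      + (c * \<alpha> * norm x powr (\<alpha> - 2) - c\<^sup>2 * norm x powr (2 * \<alpha> - 2)) * (u x)\<^sup>2)"
      by (rule integrable_compact_support[OF C(1)])
         (use C u(2) in \<open>auto intro!: continuous_intros\<close>)
    fix x :: 'a
    have "c * \<alpha> / 2 * (norm x powr (\<alpha> - 2) * (u x)\<^sup>2)
       \<le> (c * \<alpha> * norm x powr (\<alpha> - 2) - c\<^sup>2 * norm x powr (2 * \<alpha> - 2)) * (u x)\<^sup>2"
    proof (cases "x \<in> K")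
      case True
      then have x: "norm x > 0" "norm x \<le> R" using u(2) K by auto
      have "norm x powr \<alpha> \<le> R powr \<alpha>" using x assms by (intro powr_mono2) auto
      then have "c * norm x powr \<alpha> \<le> \<alpha> / 2"
        using c(2) mult_left_mono[of "norm x powr \<alpha>" "R powr \<alpha>" c] c(1) by linarith
      then have "(c * norm x powr (\<alpha> - 2)) * (c * norm x powr \<alpha>) \<le> (c * norm x powr (\<alpha> - 2)) * (\<alpha> / 2)"
        using c by (intro mult_left_mono) auto
      moreover have "norm x powr (2 * \<alpha> - 2) = norm x powr (\<alpha> - 2) * norm x powr \<alpha>"
        by (simp flip: powr_add)
      ultimately have "c * \<alpha> / 2 * norm x powr (\<alpha> - 2) \<le> c * \<alpha> * norm x powr (\<alpha> - 2) - c\<^sup>2 * norm x powr (2 * \<alpha> - 2)"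
        by (simp add: power2_eq_square algebra_simps)
      from mult_right_mono[OF this, of "(u x)\<^sup>2"] show ?thesis by (simp add: mult.assoc)
    qed (simp add: C)
    then show "c * \<alpha> / 2 * (norm x powr (\<alpha> - 2) * (u x)\<^sup>2) \<le>
       (norm (u' x + ((\<beta> * norm x powr (-2) + c * norm x powr (\<alpha> - 2)) * u x) *\<^sub>R x))\<^sup>2
      + (c * \<alpha> * norm x powr (\<alpha> - 2) - c\<^sup>2 * norm x powr (2 * \<alpha> - 2)) * (u x)\<^sup>2"
      by (smt (verit) zero_le_power2)
  qed
  then have "c * \<alpha> / 2 * (LINT x|lborel. norm x powr (\<alpha> - 2) * (u x)\<^sup>2) \<le> hardy_form u u'"
    by simp
  from mult_left_mono[OF this, of "4 * R powr \<alpha> / \<alpha>\<^sup>2"]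
  have "4 * R powr \<alpha> / \<alpha>\<^sup>2 * (c * \<alpha> / 2) * (LINT x|lborel. norm x powr (\<alpha> - 2) * (u x)\<^sup>2)
      \<le> 4 * R powr \<alpha> / \<alpha>\<^sup>2 * hardy_form u u'"
    by (simp add: mult.assoc)
  moreover have "4 * R powr \<alpha> / \<alpha>\<^sup>2 * (c * \<alpha> / 2) = 1"
    using Ra assms by (simp add: c_def field_simps power2_eq_square)
  ultimately show ?thesis by (simp only: mult_1_left)
qed

text \<open>By the first form of \<open>hardy_form_eq\<close> the gradient differs from a field
  \<open>w\<close>, whose squared norm integrates to the Hardy form, by
  \<open>\<beta> * norm x powr (-2) * u x\<close> times \<open>x\<close>. On \<open>K\<close> the
  weight on \<open>w\<close> is at most \<open>R powr \<alpha>\<close>, and the difference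
  contributes the weighted integral of \<open>u^2\<close>.\<close>

lemma weighted_hardy_gradient:
  fixes u :: "'a::euclidean_space \<Rightarrow> real"
  assumes u: "C1_supp u u' K" "0 \<notin> K" and K: "K \<subseteq> cball 0 R" and "R > 0" "\<alpha> > 0"
    and \<beta>: "\<beta> = (real DIM('a) - 2) / 2"
  shows "(LINT x|lborel. norm x powr \<alpha> * (norm (u' x))\<^sup>2)
    \<le> 2 * R powr \<alpha> * hardy_form u u' + 2 * \<beta>\<^sup>2 * (LINT x|lborel. norm x powr (\<alpha> - 2) * (u x)\<^sup>2)"
proof -
  note C = C1_suppD[OF u(1)]
  define w where "w x = u' x + (\<beta> * norm x powr (-2) * u x) *\<^sub>R x" for x
  have i1: "integrable lborel (\<lambda>x. norm x powr \<alpha> * (norm (u' x))\<^sup>2)"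
    by (rule integrable_compact_support[OF C(1)])
         (use C u(2) in \<open>auto intro!: continuous_intros\<close>)
  have i2: "integrable lborel (\<lambda>x. (norm (w x))\<^sup>2)" unfolding w_def
    by (rule integrable_compact_support[OF C(1)])
         (use C u(2) in \<open>auto intro!: continuous_intros\<close>)
  have i3: "integrable lborel (\<lambda>x. norm x powr (\<alpha> - 2) * (u x)\<^sup>2)"
    by (rule integrable_compact_support[OF C(1)])
         (use C u(2) in \<open>auto intro!: continuous_intros\<close>)
  have "(LINT x|lborel. norm x powr \<alpha> * (norm (u' x))\<^sup>2)
    \<le> (LINT x|lborel. 2 * R powr \<alpha> * (norm (w x))\<^sup>2 + 2 * \<beta>\<^sup>2 * (norm x powr (\<alpha> - 2) * (u x)\<^sup>2))"
  proof (rule integral_mono[OF i1])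
    show "integrable lborel (\<lambda>x. 2 * R powr \<alpha> * (norm (w x))\<^sup>2 + 2 * \<beta>\<^sup>2 * (norm x powr (\<alpha> - 2) * (u x)\<^sup>2))"
      using i2 i3 by simp
    fix x :: 'a
    show "norm x powr \<alpha> * (norm (u' x))\<^sup>2 \<le> 2 * R powr \<alpha> * (norm (w x))\<^sup>2 + 2 * \<beta>\<^sup>2 * (norm x powr (\<alpha> - 2) * (u x)\<^sup>2)"
    proof (cases "x \<in> K")
      case True
      then have x: "norm x > 0" "norm x \<le> R" using u(2) K by auto
      have "norm (u' x) \<le> norm (w x) + norm ((\<beta> * norm x powr (-2) * u x) *\<^sub>R x)"
        unfolding w_def by (metis add_diff_cancel_right' norm_triangle_ineq4)
      then have "(norm (u' x))\<^sup>2 \<le> (norm (w x) + norm ((\<beta> * norm x powr (-2) * u x) *\<^sub>R x))\<^sup>2"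
        by (rule power_mono) simp
      also have "\<dots> \<le> 2 * (norm (w x))\<^sup>2 + 2 * (norm ((\<beta> * norm x powr (-2) * u x) *\<^sub>R x))\<^sup>2"
        by (smt (verit) power2_sum sum_squares_bound)
      also have "(norm ((\<beta> * norm x powr (-2) * u x) *\<^sub>R x))\<^sup>2 = \<beta>\<^sup>2 * (norm x powr (-2) * (u x)\<^sup>2)"
        using x by (simp add: power_mult_distrib powr_minus_divide power2_eq_square)
      finally have "norm x powr \<alpha> * (norm (u' x))\<^sup>2
         \<le> norm x powr \<alpha> * (2 * (norm (w x))\<^sup>2 + 2 * (\<beta>\<^sup>2 * (norm x powr (-2) * (u x)\<^sup>2)))"
        by (intro mult_left_mono) auto
      also have "\<dots> = 2 * (norm x powr \<alpha> * (norm (w x))\<^sup>2) + 2 * \<beta>\<^sup>2 * (norm x powr (\<alpha> - 2) * (u x)\<^sup>2)"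
        using powr_add[of "norm x" \<alpha> "-2"] by (simp add: algebra_simps)
      also have "norm x powr \<alpha> * (norm (w x))\<^sup>2 \<le> R powr \<alpha> * (norm (w x))\<^sup>2"
        using x assms by (intro mult_right_mono powr_mono2) auto
      finally show ?thesis by (simp add: mult.assoc)
    qed (simp add: C)
  qed
  also have "\<dots> = 2 * R powr \<alpha> * (LINT x|lborel. (norm (w x))\<^sup>2) + 2 * \<beta>\<^sup>2 * (LINT x|lborel. norm x powr (\<alpha> - 2) * (u x)\<^sup>2)"
    using i2 i3 by simp
  also have "(LINT x|lborel. (norm (w x))\<^sup>2) = hardy_form u u'"
    using hardy_form_eq(1)[OF u \<beta>] by (simp add: w_def)
  finally show ?thesis .
qed

text \<open>The constant is uniform in \<open>u\<close> and \<open>K\<close>. The logarithmic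
  Sobolev estimate uses the exponent 2 \<gamma>, the local boundary estimate the exponent 1, and the
  bound of the plain \<open>L^2\<close> norm the exponent 2.\<close>

lemma weighted_hardy:
  assumes "R > 0" "\<alpha> > 0"
  obtains C where "C > 0"
    "\<And>(u :: 'a::euclidean_space \<Rightarrow> real) u' K. \<lbrakk>C1_supp u u' K; 0 \<notin> K; K \<subseteq> cball 0 R\<rbrakk> \<Longrightarrow>
       (LINT x|lborel. norm x powr \<alpha> * (norm (u' x))\<^sup>2) + (LINT x|lborel. norm x powr (\<alpha> - 2) * (u x)\<^sup>2)
         \<le> C * hardy_form u u'"
proof -
  define \<beta> where "\<beta> = (real DIM('a) - 2) / 2"
  define D where "D = 4 * R powr \<alpha> / \<alpha>\<^sup>2"
  have D: "D > 0" using assms by (simp add: D_def)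
  show ?thesis
  proof (rule that[of "2 * R powr \<alpha> + (2 * \<beta>\<^sup>2 + 1) * D"])
    show "2 * R powr \<alpha> + (2 * \<beta>\<^sup>2 + 1) * D > 0"
      using D assms by (intro add_nonneg_pos mult_pos_pos) (auto intro: add_nonneg_pos)
    fix u :: "'a \<Rightarrow> real" and u' K assume u: "C1_supp u u' K" "0 \<notin> K" "K \<subseteq> cball 0 R"
    let ?I = "LINT x|lborel. norm x powr (\<alpha> - 2) * (u x)\<^sup>2"
    have "?I \<le> D * hardy_form u u'"
      using weighted_hardy_L2[OF u assms] by (simp add: D_def)
    from mult_left_mono[OF this, of "2 * \<beta>\<^sup>2 + 1"]
    have "(2 * \<beta>\<^sup>2 + 1) * ?I \<le> (2 * \<beta>\<^sup>2 + 1) * (D * hardy_form u u')" by simp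
    then show "(LINT x|lborel. norm x powr \<alpha> * (norm (u' x))\<^sup>2) + ?I
       \<le> (2 * R powr \<alpha> + (2 * \<beta>\<^sup>2 + 1) * D) * hardy_form u u'"
      using weighted_hardy_gradient[OF u assms \<beta>_def] by (simp add: algebra_simps)
  qed
qed

section \<open>Superlevel set estimates by averaged translations\<close>

text \<open>The increment \<open>m\<close> is the mean over the segment of the derivative
  \<open>q\<close>, and the integral of \<open>(q - m)^2\<close> is nonnegative. The nonnegative
  integral on the right lets the later exchange of integrations go through without integrability
  conditions.\<close>

lemma square_increment_le_nn_integral:
  fixes v :: "'a::euclidean_space \<Rightarrow> real"
  assumes "C1_supp v v' K"
  shows "ennreal ((v (x + h) - v x)\<^sup>2) \<le> (\<integral>\<^sup>+t. indicator {0..1} t * ennreal ((v' (x + t *\<^sub>R h) \<bullet> h)\<^sup>2) \<partial>lborel)"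
proof -
  note C = C1_suppD[OF assms]
  define q where "q t = v' (x + t *\<^sub>R h) \<bullet> h" for t
  define m where "m = v (x + h) - v x"
  have cq: "continuous_on S q" for S
    unfolding q_def by (intro continuous_intros continuous_on_compose2[OF C(3)[of UNIV]]) auto
  have 1: "(q has_integral m) {0..1}"
    using fundamental_theorem_of_calculus[of 0 1 "\<lambda>t. v (x + t *\<^sub>R h)" q] GDERIV_line[OF C(2)]
    by (auto simp: m_def q_def has_real_derivative_iff_has_vector_derivative[symmetric] has_field_derivative_at_within)
  have 2: "((\<lambda>t. (q t)\<^sup>2) has_integral integral {0..1} (\<lambda>t. (q t)\<^sup>2)) {0..1}"
    by (intro integrable_integral integrable_continuous_real continuous_intros cq)
  have "((\<lambda>t. (q t)\<^sup>2 - 2 * m * q t + m\<^sup>2) has_integral integral {0..1} (\<lambda>t. (q t)\<^sup>2) - 2 * m * m + m\<^sup>2) {0..1}"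
    using has_integral_add[OF has_integral_diff[OF 2 has_integral_mult_right[OF 1, of "2 * m"]] has_integral_const_real[of "m\<^sup>2" 0 1]]
    by simp
  then have "0 \<le> integral {0..1} (\<lambda>t. (q t)\<^sup>2) - 2 * m * m + m\<^sup>2"
    by (rule has_integral_nonneg) (use zero_le_power2[of "q _ - m"] in \<open>simp add: power2_diff algebra_simps\<close>)
  then have le: "m\<^sup>2 \<le> integral {0..1} (\<lambda>t. (q t)\<^sup>2)"
    by (simp add: power2_eq_square)
  have "(\<integral>\<^sup>+t. indicator {0..1} t * ennreal ((q t)\<^sup>2) \<partial>lborel) = ennreal (integral {0..1} (\<lambda>t. (q t)\<^sup>2))"
    using nn_integral_has_integral_lebesgue[OF _ 2] cq
    by (simp add: nn_integral_completion mult.commute nn_integral_set_ennreal ennreal_mult' ennreal_indicator)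
  then show ?thesis
    using le by (simp add: m_def q_def ennreal_leI)
qed

lemma nn_integral_eq_lborel_integral:
  fixes f :: "'a::euclidean_space \<Rightarrow> real"
  assumes "compact K" "continuous_on K f" "\<And>x. x \<notin> K \<Longrightarrow> f x = 0" "\<And>x. 0 \<le> f x"
  shows "(\<integral>\<^sup>+x. ennreal (f x) \<partial>lborel) = ennreal (LINT x|lborel. f x)"
  using assms by (intro nn_integral_eq_integral integrable_compact_support) auto

text \<open>Integrating the bound along segments over all \<open>x\<close> and exchanging the order,
  translation invariance removes the shift by \<open>t *\<^sub>R h\<close>; the parameter interval
  has length 1.\<close>

lemma translation_estimate:
  fixes v :: "'a::euclidean_space \<Rightarrow> real"
  assumes "C1_supp v v' K"
  shows "(\<integral>\<^sup>+x. ennreal ((v (x + h) - v x)\<^sup>2) \<partial>lborel)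
    \<le> ennreal ((norm h)\<^sup>2 * (LINT x|lborel. (norm (v' x))\<^sup>2))"
proof -
  note C = C1_suppD[OF assms]
  have mv: "(\<lambda>x. v' x) \<in> borel_measurable borel"
    using C(3) by (rule borel_measurable_continuous_onI)
  have m2: "(\<lambda>x. ennreal ((v' x \<bullet> h)\<^sup>2)) \<in> borel_measurable borel"
    using mv by measurable
  have meas: "(\<lambda>(x, t). indicator {0..1} t * ennreal ((v' (x + t *\<^sub>R h) \<bullet> h)\<^sup>2))
      \<in> borel_measurable (lborel \<Otimes>\<^sub>M lborel)"
    using mv by measurable
  have "(\<integral>\<^sup>+x. ennreal ((v (x + h) - v x)\<^sup>2) \<partial>lborel)
     \<le> (\<integral>\<^sup>+x. \<integral>\<^sup>+t. indicator {0..1} t * ennreal ((v' (x + t *\<^sub>R h) \<bullet> h)\<^sup>2) \<partial>lborel \<partial>lborel)"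
    by (intro nn_integral_mono square_increment_le_nn_integral[OF assms])
  also have "\<dots> = (\<integral>\<^sup>+t. \<integral>\<^sup>+x. indicator {0..1} t * ennreal ((v' (x + t *\<^sub>R h) \<bullet> h)\<^sup>2) \<partial>lborel \<partial>lborel)"
    using lborel_pair.Fubini'[OF meas] by simp
  also have "\<dots> = (\<integral>\<^sup>+t. indicator {0..1::real} t * (\<integral>\<^sup>+x. ennreal ((v' x \<bullet> h)\<^sup>2) \<partial>lborel) \<partial>lborel)"
  proof (rule nn_integral_cong)
    fix t :: real
    have m3: "(\<lambda>x. ennreal ((v' (x + t *\<^sub>R h) \<bullet> h)\<^sup>2)) \<in> borel_measurable borel"
      using mv by measurable
    show "(\<integral>\<^sup>+x. indicator {0..1} t * ennreal ((v' (x + t *\<^sub>R h) \<bullet> h)\<^sup>2) \<partial>lborel)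
       = indicator {0..1} t * (\<integral>\<^sup>+x. ennreal ((v' x \<bullet> h)\<^sup>2) \<partial>lborel)"
      using m3 lborel_nn_integral_translate[OF m2, of "t *\<^sub>R h"]
      by (simp add: nn_integral_cmult add.commute)
  qed
  also have "\<dots> = (\<integral>\<^sup>+x. ennreal ((v' x \<bullet> h)\<^sup>2) \<partial>lborel)"
    by (simp add: nn_integral_multc)
  also have "\<dots> \<le> (\<integral>\<^sup>+x. ennreal ((norm h)\<^sup>2 * (norm (v' x))\<^sup>2) \<partial>lborel)"
  proof (intro nn_integral_mono ennreal_leI)
    fix x
    have "(v' x \<bullet> h)\<^sup>2 \<le> (norm (v' x) * norm h)\<^sup>2"
      using power_mono[OF Cauchy_Schwarz_ineq2[of "v' x" h], of 2] by simp
    then show "(v' x \<bullet> h)\<^sup>2 \<le> (norm h)\<^sup>2 * (norm (v' x))\<^sup>2"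
      by (simp add: power_mult_distrib mult.commute)
  qed
  also have "\<dots> = ennreal (LINT x|lborel. (norm h)\<^sup>2 * (norm (v' x))\<^sup>2)"
    by (rule nn_integral_eq_lborel_integral[OF C(1)]) (use C in \<open>auto intro!: continuous_intros\<close>)
  finally show ?thesis by simp
qed

text \<open>Averaging \<open>v(x)\<^sup>2 \<le> 2 (v(x + h) - v(x))\<^sup>2 + 2 v(x + h)\<^sup>2\<close> over \<open>h\<close> in the ball of radius \<open>s\<close>, the
  second term is absorbed as soon as \<open>v(x)\<^sup>2\<close> exceeds four times the mean of \<open>v\<^sup>2\<close>.\<close>
lemma superlevel_L2_estimate:
  fixes v :: "'a::euclidean_space \<Rightarrow> real"
  assumes v: "C1_supp v v' K" and s: "s > 0"
    and l: "(LINT x|lborel. (v x)\<^sup>2) \<le> l\<^sup>2 * measure lborel (ball (0::'a) s)"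
  shows "(\<integral>\<^sup>+x. indicator {x. 4 * l\<^sup>2 \<le> (v x)\<^sup>2} x * ennreal ((v x)\<^sup>2) \<partial>lborel)
    \<le> ennreal (4 * s\<^sup>2 * (LINT x|lborel. (norm (v' x))\<^sup>2))"
proof -
  note C = C1_suppD[OF v]
  define V where "V = measure lborel (ball (0::'a) s)"
  have V: "V > 0" using s by (simp add: V_def)
  have emV: "emeasure lborel (ball (0::'a) s) = ennreal V"
    unfolding V_def by (rule emeasure_eq_ennreal_measure) (use emeasure_lborel_ball_finite[of "0::'a" s] in simp)
  have mv[measurable]: "v \<in> borel_measurable borel"
    using C(5) by (rule borel_measurable_continuous_onI)
  let ?B = "indicator (ball (0::'a) s) :: 'a \<Rightarrow> ennreal"
  have mB[measurable]: "?B \<in> borel_measurable borel"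
    by (auto intro!: borel_measurable_indicator)
  have iB: "(\<integral>\<^sup>+h. ?B h * c \<partial>lborel) = ennreal V * c" for c
    by (subst nn_integral_multc) (simp_all add: emV)
  have pt: "indicator {x. 4 * l\<^sup>2 \<le> (v x)\<^sup>2} x * ennreal ((v x)\<^sup>2)
       \<le> ennreal (4 / V) * (\<integral>\<^sup>+h. ?B h * ennreal ((v (x + h) - v x)\<^sup>2) \<partial>lborel)" for x
  proof (cases "4 * l\<^sup>2 \<le> (v x)\<^sup>2")
    case True
    let ?I = "\<integral>\<^sup>+h. ?B h * ennreal ((v (x + h) - v x)\<^sup>2) \<partial>lborel"
    have "ennreal (V * (v x)\<^sup>2) = (\<integral>\<^sup>+h. ?B h * ennreal ((v x)\<^sup>2) \<partial>lborel)"
      using V by (simp add: iB ennreal_mult')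
    also have "\<dots> \<le> (\<integral>\<^sup>+h. 2 * (?B h * ennreal ((v (x + h) - v x)\<^sup>2)) + 2 * ennreal ((v (x + h))\<^sup>2) \<partial>lborel)"
    proof (rule nn_integral_mono)
      fix h
      have "(v x)\<^sup>2 \<le> 2 * (v (x + h) - v x)\<^sup>2 + 2 * (v (x + h))\<^sup>2"
        using zero_le_power2[of "2 * v (x + h) - v x"] by (simp add: power2_eq_square algebra_simps)
      then have "ennreal ((v x)\<^sup>2) \<le> ennreal (2 * (v (x + h) - v x)\<^sup>2 + 2 * (v (x + h))\<^sup>2)"
        by (rule ennreal_leI)
      also have "\<dots> = 2 * ennreal ((v (x + h) - v x)\<^sup>2) + 2 * ennreal ((v (x + h))\<^sup>2)"
        by (simp add: ennreal_mult')
      finally have "ennreal ((v x)\<^sup>2) \<le> 2 * ennreal ((v (x + h) - v x)\<^sup>2) + 2 * ennreal ((v (x + h))\<^sup>2)" .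
      then show "?B h * ennreal ((v x)\<^sup>2) \<le> 2 * (?B h * ennreal ((v (x + h) - v x)\<^sup>2)) + 2 * ennreal ((v (x + h))\<^sup>2)"
        by (cases "h \<in> ball 0 s") auto
    qed
    also have "\<dots> = 2 * ?I + 2 * (\<integral>\<^sup>+h. ennreal ((v (x + h))\<^sup>2) \<partial>lborel)"
      by (simp add: nn_integral_add nn_integral_cmult)
    also have "(\<integral>\<^sup>+h. ennreal ((v (x + h))\<^sup>2) \<partial>lborel) = ennreal (LINT x|lborel. (v x)\<^sup>2)"
      using lborel_nn_integral_translate[of "\<lambda>x. ennreal ((v x)\<^sup>2)" x]
        nn_integral_eq_lborel_integral[OF C(1), of "\<lambda>x. (v x)\<^sup>2"] C
      by (simp add: continuous_intros)
    \<comment> \<open>On the superlevel set the hypothesis on \<open>l\<close> bounds the total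
      integral of \<open>v^2\<close> by a quarter of \<open>V * (v x)^2\<close>. With the factor 2
      in front, half of the left side is absorbed.\<close>
    also have "ennreal (LINT x|lborel. (v x)\<^sup>2) \<le> ennreal (V * (v x)\<^sup>2 / 4)"
    proof (rule ennreal_leI)
      have "l\<^sup>2 * V \<le> (v x)\<^sup>2 / 4 * V" using True V by (intro mult_right_mono) auto
      then show "(LINT x|lborel. (v x)\<^sup>2) \<le> V * (v x)\<^sup>2 / 4" using l by (simp add: V_def mult.commute)
    qed
    finally have le: "ennreal (V * (v x)\<^sup>2) \<le> 2 * ?I + 2 * ennreal (V * (v x)\<^sup>2 / 4)"
      by (simp add: add_left_mono mult_left_mono)
    show ?thesis
    \<comment> \<open>Absorption is a subtraction, which is legitimate among extended reals only for
      finite values, so the infinite case is split off.\<close>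
    proof (cases "?I = top")
      case True
      then show ?thesis using V by (simp add: ennreal_mult_top)
    next
      case False
      then obtain i where i: "?I = ennreal i" "i \<ge> 0" by (cases ?I) auto
      have e: "ennreal (2 * a + 2 * b) = 2 * ennreal a + 2 * ennreal b" if "0 \<le> a" "0 \<le> b" for a b
        using that by (simp add: ennreal_mult')
      have "V * (v x)\<^sup>2 \<le> 2 * i + 2 * (V * (v x)\<^sup>2 / 4)"
      proof -
        have "2 * ?I + 2 * ennreal (V * (v x)\<^sup>2 / 4) = ennreal (2 * i + 2 * (V * (v x)\<^sup>2 / 4))"
          unfolding i(1) using V i(2) by (intro e[symmetric]) auto
        then have "ennreal (V * (v x)\<^sup>2) \<le> ennreal (2 * i + 2 * (V * (v x)\<^sup>2 / 4))"
          using le by (simp only:)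
        then show ?thesis using V i by (subst (asm) ennreal_le_iff) auto
      qed
      then have "(v x)\<^sup>2 \<le> 4 / V * i" using V by (simp add: field_simps)
      then show ?thesis using True V i
        by (simp add: ennreal_leI flip: ennreal_mult')
    qed
  qed simp
  have meas: "(\<lambda>(x, h). ?B h * ennreal ((v (x + h) - v x)\<^sup>2)) \<in> borel_measurable (lborel \<Otimes>\<^sub>M lborel)"
    by measurable
  have "(\<integral>\<^sup>+x. indicator {x. 4 * l\<^sup>2 \<le> (v x)\<^sup>2} x * ennreal ((v x)\<^sup>2) \<partial>lborel)
    \<le> (\<integral>\<^sup>+x. ennreal (4 / V) * (\<integral>\<^sup>+h. ?B h * ennreal ((v (x + h) - v x)\<^sup>2) \<partial>lborel) \<partial>lborel)"
    by (intro nn_integral_mono pt)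
  also have "\<dots> = ennreal (4 / V) * (\<integral>\<^sup>+x. \<integral>\<^sup>+h. ?B h * ennreal ((v (x + h) - v x)\<^sup>2) \<partial>lborel \<partial>lborel)"
    by (rule nn_integral_cmult) measurable
  also have "(\<integral>\<^sup>+x. \<integral>\<^sup>+h. ?B h * ennreal ((v (x + h) - v x)\<^sup>2) \<partial>lborel \<partial>lborel)
     = (\<integral>\<^sup>+h. \<integral>\<^sup>+x. ?B h * ennreal ((v (x + h) - v x)\<^sup>2) \<partial>lborel \<partial>lborel)"
    using lborel_pair.Fubini'[OF meas] by simp
  also have "\<dots> = (\<integral>\<^sup>+h. ?B h * (\<integral>\<^sup>+x. ennreal ((v (x + h) - v x)\<^sup>2) \<partial>lborel) \<partial>lborel)"
    by (simp add: nn_integral_cmult)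
  also have "\<dots> \<le> (\<integral>\<^sup>+h. ?B h * ennreal (s\<^sup>2 * (LINT x|lborel. (norm (v' x))\<^sup>2)) \<partial>lborel)"
  proof (rule nn_integral_mono)
    fix h :: 'a
    show "?B h * (\<integral>\<^sup>+x. ennreal ((v (x + h) - v x)\<^sup>2) \<partial>lborel) \<le> ?B h * ennreal (s\<^sup>2 * (LINT x|lborel. (norm (v' x))\<^sup>2))"
    proof (cases "h \<in> ball 0 s")
      case True
      then have "(norm h)\<^sup>2 \<le> s\<^sup>2" by (intro power_mono) auto
      then have "(norm h)\<^sup>2 * (LINT x|lborel. (norm (v' x))\<^sup>2) \<le> s\<^sup>2 * (LINT x|lborel. (norm (v' x))\<^sup>2)"
        by (rule mult_right_mono) simp
      then show ?thesis using translation_estimate[OF v, of h]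
        by (intro mult_left_mono) (auto intro: order_trans ennreal_leI)
    qed simp
  qed
  also have "\<dots> = ennreal V * ennreal (s\<^sup>2 * (LINT x|lborel. (norm (v' x))\<^sup>2))"
    by (rule iB)
  finally have "(\<integral>\<^sup>+x. indicator {x. 4 * l\<^sup>2 \<le> (v x)\<^sup>2} x * ennreal ((v x)\<^sup>2) \<partial>lborel)
     \<le> ennreal (4 / V) * (ennreal V * ennreal (s\<^sup>2 * (LINT x|lborel. (norm (v' x))\<^sup>2)))"
    by (simp add: mult_left_mono)
  also have "\<dots> = ennreal (4 * s\<^sup>2 * (LINT x|lborel. (norm (v' x))\<^sup>2))"
    using V by (simp add: mult.assoc flip: ennreal_mult')
  finally show ?thesis .
qed

lemma superlevel_L2_estimate_Bochner:
  fixes v :: "'a::euclidean_space \<Rightarrow> real"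
  assumes v: "C1_supp v v' K" and s: "s > 0"
    and l: "(LINT x|lborel. (v x)\<^sup>2) \<le> l\<^sup>2 * measure lborel (ball (0::'a) s)"
  shows "integrable lborel (\<lambda>x. indicator {x. 4 * l\<^sup>2 \<le> (v x)\<^sup>2} x * (v x)\<^sup>2)"
    and "(LINT x|lborel. indicator {x. 4 * l\<^sup>2 \<le> (v x)\<^sup>2} x * (v x)\<^sup>2)
    \<le> 4 * s\<^sup>2 * (LINT x|lborel. (norm (v' x))\<^sup>2)"
proof -
  note C = C1_suppD[OF v]
  have mv[measurable]: "v \<in> borel_measurable borel"
    using C(5) by (rule borel_measurable_continuous_onI)
  have i: "integrable lborel (\<lambda>x. (v x)\<^sup>2)"
    by (rule integrable_compact_support[OF C(1)]) (use C in \<open>auto intro!: continuous_intros\<close>)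
  show int: "integrable lborel (\<lambda>x. indicator {x. 4 * l\<^sup>2 \<le> (v x)\<^sup>2} x * (v x)\<^sup>2)"
    by (rule Bochner_Integration.integrable_bound[OF i]) (auto simp: indicator_def)
  have "ennreal (LINT x|lborel. indicator {x. 4 * l\<^sup>2 \<le> (v x)\<^sup>2} x * (v x)\<^sup>2)
    = (\<integral>\<^sup>+x. ennreal (indicator {x. 4 * l\<^sup>2 \<le> (v x)\<^sup>2} x * (v x)\<^sup>2) \<partial>lborel)"
    using int by (intro nn_integral_eq_integral[symmetric]) auto
  also have "\<dots> = (\<integral>\<^sup>+x. indicator {x. 4 * l\<^sup>2 \<le> (v x)\<^sup>2} x * ennreal ((v x)\<^sup>2) \<partial>lborel)"
    by (intro nn_integral_cong) (auto simp: indicator_def)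
  also have "\<dots> \<le> ennreal (4 * s\<^sup>2 * (LINT x|lborel. (norm (v' x))\<^sup>2))"
    by (rule superlevel_L2_estimate[OF v s l])
  finally show "(LINT x|lborel. indicator {x. 4 * l\<^sup>2 \<le> (v x)\<^sup>2} x * (v x)\<^sup>2)
    \<le> 4 * s\<^sup>2 * (LINT x|lborel. (norm (v' x))\<^sup>2)"
    by (simp add: ennreal_le_iff)
qed

section \<open>The logarithmic Sobolev inequality with weight at the origin\<close>

text \<open>Only the highest dyadic level reached by \<open>t\<close> matters: for t between 2^k and
  2^(k+1) the single summand of index \<open>k\<close> already exceeds
  \<open>t powr \<delta>\<close>. Below 1 the leading constant suffices.\<close>

lemma dyadic_powr_bound:
  fixes t \<delta> :: real
  assumes "0 \<le> t" "t < 2 ^ m" "\<delta> > 0"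
  shows "t powr \<delta> \<le> 1 + (\<Sum>k<m. (2 powr \<delta>) ^ Suc k * indicator {t. 2 ^ k \<le> t} t)"
  using assms(2)
proof (induction m)
  case 0
  then show ?case using assms powr_mono2[of \<delta> t 1] by simp
next
  case (Suc m)
  show ?case
  proof (cases "t < 2 ^ m")
    case True
    with Suc.IH show ?thesis by simp
  next
    case False
    have "t powr \<delta> \<le> (2 ^ Suc m) powr \<delta>"
      using assms Suc.prems by (intro powr_mono2) auto
    also have "\<dots> = (2 powr \<delta>) ^ Suc m"
      by (simp add: powr_realpow[symmetric] powr_powr mult.commute del: power_Suc)
    finally have "t powr \<delta> \<le> (2 powr \<delta>) ^ Suc m * indicator {t. 2 ^ m \<le> t} t"
      using False by simp
    moreover have "0 \<le> (\<Sum>k<m. (2 powr \<delta>) ^ Suc k * indicator {t. 2 ^ k \<le> t} t :: real)"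
      by (intro sum_nonneg) auto
    ultimately show ?thesis by simp
  qed
qed

text \<open>The superlevel estimate is applied at level \<open>l * 2 ^ k\<close> with radius
  \<open>s / q ^ k\<close>. The choice of \<delta> gives q^N = 4, so the ball loses the factor 4^k
  that the squared level gains and the hypothesis persists for every \<open>k\<close>. The estimate
  then decays like q^(-2k) against the dyadic weight q^(k+1), which leaves a geometric series of
  ratio 1/q.\<close>

lemma superquadratic_integral_bound:
  fixes v :: "'a::euclidean_space \<Rightarrow> real"
  assumes v: "C1_supp v v' K" "\<And>x. 0 \<le> v x" and s: "s > 0" and l: "l > 0"
    and vl: "(LINT x|lborel. (v x)\<^sup>2) \<le> l\<^sup>2 * measure lborel (ball (0::'a) s)"
    and \<delta>: "\<delta> = 2 / real DIM('a)" and q: "q = 2 powr \<delta>"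
  shows "integrable lborel (\<lambda>x. (v x)\<^sup>2 * (v x / (2 * l)) powr \<delta>)"
    and "(LINT x|lborel. (v x)\<^sup>2 * (v x / (2 * l)) powr \<delta>)
      \<le> (LINT x|lborel. (v x)\<^sup>2) + 4 * q / (1 - 1 / q) * s\<^sup>2 * (LINT x|lborel. (norm (v' x))\<^sup>2)"
proof -
  note C = C1_suppD[OF v(1)]
  have \<delta>0: "\<delta> > 0" using \<delta> by simp
  have q1: "q > 1" using q \<delta>0 by simp
  have qN: "q ^ DIM('a) = 4"
    using \<delta> by (simp add: q powr_powr flip: powr_realpow)
  obtain B where B: "\<And>x. v x \<le> B"
  proof -
    obtain B where "\<And>x. x \<in> K \<Longrightarrow> \<bar>v x\<bar> \<le> B"
      using compact_imp_bounded[OF compact_continuous_image[OF C(5) C(1)]]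
      unfolding bounded_iff by auto
    then have "v x \<le> max B 0" for x
      using C(4)[of x] by (cases "x \<in> K") (fastforce simp: le_max_iff_disj)+
    then show ?thesis using that by blast
  qed
  \<comment> \<open>As \<open>v\<close> is bounded, finitely many levels suffice. The number
    \<open>m\<close> depends on \<open>v\<close>, but the final bound by the full geometric series
    does not involve it.\<close>
  obtain m where m: "B / (2 * l) < 2 ^ m"
    using real_arch_pow[of 2 "B / (2 * l)"] by auto
  have vm: "v x / (2 * l) < 2 ^ m" for x
    using B[of x] m l by (meson divide_right_mono le_less_trans less_imp_le mult_pos_pos zero_less_numeral)
  define D where "D = (LINT x|lborel. (norm (v' x))\<^sup>2)"
  have D: "D \<ge> 0" by (simp add: D_def)
  define I where "I k x = indicator {x. 4 * (l * 2 ^ k)\<^sup>2 \<le> (v x)\<^sup>2} x * (v x)\<^sup>2" for k x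
  have I: "integrable lborel (I k)" "(LINT x|lborel. I k x) \<le> 4 * (s / q ^ k)\<^sup>2 * D" for k
  proof -
    have "measure lborel (ball (0::'a) (s / q ^ k)) = measure lborel (ball (0::'a) s) / (q ^ k) ^ DIM('a)"
      using s q1 by (simp add: content_ball power_divide)
    also have "(q ^ k) ^ DIM('a) = 4 ^ k"
      by (metis mult.commute power_mult qN)
    finally have meas: "measure lborel (ball (0::'a) (s / q ^ k)) = measure lborel (ball (0::'a) s) / 4 ^ k" .
    have "(2 ^ k)\<^sup>2 = (4::real) ^ k"
      by (simp add: power2_eq_square flip: power_mult_distrib)
    then have "(l * 2 ^ k)\<^sup>2 * measure lborel (ball (0::'a) (s / q ^ k)) = l\<^sup>2 * measure lborel (ball (0::'a) s)"
      by (simp add: meas power_mult_distrib)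
    then have le: "(LINT x|lborel. (v x)\<^sup>2) \<le> (l * 2 ^ k)\<^sup>2 * measure lborel (ball (0::'a) (s / q ^ k))"
      using vl by simp
    have sk: "s / q ^ k > 0" using s q1 by simp
    show "integrable lborel (I k)" "(LINT x|lborel. I k x) \<le> 4 * (s / q ^ k)\<^sup>2 * D"
      using superlevel_L2_estimate_Bochner[OF v(1) sk le] by (simp_all add: I_def[abs_def] D_def)
  qed
  have i2: "integrable lborel (\<lambda>x. (v x)\<^sup>2)"
    by (rule integrable_compact_support[OF C(1)]) (use C in \<open>auto intro!: continuous_intros\<close>)
  show i1: "integrable lborel (\<lambda>x. (v x)\<^sup>2 * (v x / (2 * l)) powr \<delta>)"
    by (rule integrable_compact_support[OF C(1)])
       (use C v(2) \<delta>0 l in \<open>auto intro!: continuous_intros continuous_on_powr'\<close>)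
  have pt: "(v x)\<^sup>2 * (v x / (2 * l)) powr \<delta> \<le> (v x)\<^sup>2 + (\<Sum>k<m. q ^ Suc k * I k x)" for x
  proof -
    have eq: "2 ^ k \<le> v x / (2 * l) \<longleftrightarrow> 4 * (l * 2 ^ k)\<^sup>2 \<le> (v x)\<^sup>2" for k
    proof -
      have "4 * (l * 2 ^ k)\<^sup>2 = (2 ^ k * (2 * l))\<^sup>2"
        by (simp add: power_mult_distrib)
      then have "4 * (l * 2 ^ k)\<^sup>2 \<le> (v x)\<^sup>2 \<longleftrightarrow> 2 ^ k * (2 * l) \<le> v x"
        using v(2)[of x] l by (simp add: power_mono_iff)
      then show ?thesis using l by (simp add: pos_le_divide_eq)
    qed
    have "(v x / (2 * l)) powr \<delta> \<le> 1 + (\<Sum>k<m. q ^ Suc k * indicator {t. 2 ^ k \<le> t} (v x / (2 * l)))"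
      unfolding q using v(2)[of x] l by (intro dyadic_powr_bound vm \<delta>0) auto
    then have "(v x)\<^sup>2 * (v x / (2 * l)) powr \<delta>
       \<le> (v x)\<^sup>2 * (1 + (\<Sum>k<m. q ^ Suc k * indicator {t. 2 ^ k \<le> t} (v x / (2 * l))))"
      by (intro mult_left_mono) auto
    also have "\<dots> = (v x)\<^sup>2 + (\<Sum>k<m. q ^ Suc k * I k x)"
      unfolding distrib_left sum_distrib_left
      by (intro arg_cong2[where f = "(+)"] sum.cong refl) (simp_all add: I_def indicator_def eq)
    finally show ?thesis .
  qed
  have "(LINT x|lborel. (v x)\<^sup>2 * (v x / (2 * l)) powr \<delta>) \<le> (LINT x|lborel. (v x)\<^sup>2 + (\<Sum>k<m. q ^ Suc k * I k x))"
    using i1 i2 I(1) pt by (intro integral_mono) auto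
  also have "\<dots> = (LINT x|lborel. (v x)\<^sup>2) + (\<Sum>k<m. q ^ Suc k * (LINT x|lborel. I k x))"
    using i2 I(1) by simp
  also have "(\<Sum>k<m. q ^ Suc k * (LINT x|lborel. I k x)) \<le> (\<Sum>k<m. 4 * q * s\<^sup>2 * D * (1 / q) ^ k)"
  proof (rule sum_mono)
    fix k
    have "q ^ Suc k * (LINT x|lborel. I k x) \<le> q ^ Suc k * (4 * (s / q ^ k)\<^sup>2 * D)"
      using I(2) q1 by (intro mult_left_mono) auto
    also have "\<dots> = 4 * q * s\<^sup>2 * D * (1 / q) ^ k"
      using q1 by (simp add: field_simps power2_eq_square)
    finally show "q ^ Suc k * (LINT x|lborel. I k x) \<le> 4 * q * s\<^sup>2 * D * (1 / q) ^ k" .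
  qed
  also have "\<dots> = 4 * q * s\<^sup>2 * D * (\<Sum>k<m. (1 / q) ^ k)"
    by (rule sum_distrib_left[symmetric])
  also have "\<dots> \<le> 4 * q * s\<^sup>2 * D * (1 / (1 - 1 / q))"
  proof (rule mult_left_mono)
    have "(\<Sum>k<m. (1 / q) ^ k) \<le> (\<Sum>k. (1 / q) ^ k)"
      using q1 by (intro sum_le_suminf summable_geometric) auto
    also have "\<dots> = 1 / (1 - 1 / q)" using q1 by (intro suminf_geometric) auto
    finally show "(\<Sum>k<m. (1 / q) ^ k) \<le> 1 / (1 - 1 / q)" .
  qed (use q1 D in auto)
  finally show "(LINT x|lborel. (v x)\<^sup>2 * (v x / (2 * l)) powr \<delta>)
      \<le> (LINT x|lborel. (v x)\<^sup>2) + 4 * q / (1 - 1 / q) * s\<^sup>2 * (LINT x|lborel. (norm (v' x))\<^sup>2)"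
    by (simp add: D_def mult_ac)
qed

lemma C1_supp_norm_powr_mult:
  fixes u :: "'a::euclidean_space \<Rightarrow> real"
  assumes "C1_supp u u' K" "0 \<notin> K"
  shows "C1_supp (\<lambda>x. u x * norm x powr p)
    (\<lambda>x. u x *\<^sub>R ((p * norm x powr (p - 2)) *\<^sub>R x) + norm x powr p *\<^sub>R u' x) K"
proof (rule C1_supp_mult[OF assms(1), of "- {0}"])
  show "continuous_on (- {0}) (\<lambda>x :: 'a. (p * norm x powr (p - 2)) *\<^sub>R x)"
    by (intro continuous_intros) auto
qed (use assms(2) GDERIV_norm_powr in auto)

lemma integral_gradient_norm_powr_mult_le:
  fixes u :: "'a::euclidean_space \<Rightarrow> real"
  assumes u: "C1_supp u u' K" "0 \<notin> K"
  shows "(LINT x|lborel. (norm (u x *\<^sub>R ((p * norm x powr (p - 2)) *\<^sub>R x) + norm x powr p *\<^sub>R u' x))\<^sup>2)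
    \<le> 2 * (LINT x|lborel. norm x powr (2 * p) * (norm (u' x))\<^sup>2)
      + 2 * p\<^sup>2 * (LINT x|lborel. norm x powr (2 * p - 2) * (u x)\<^sup>2)"
proof -
  note C = C1_suppD[OF u(1)]
  have i1: "integrable lborel (\<lambda>x. norm x powr (2 * p) * (norm (u' x))\<^sup>2)"
    by (rule integrable_compact_support[OF C(1)])
         (use C u(2) in \<open>auto intro!: continuous_intros\<close>)
  have i3: "integrable lborel (\<lambda>x. norm x powr (2 * p - 2) * (u x)\<^sup>2)"
    by (rule integrable_compact_support[OF C(1)])
         (use C u(2) in \<open>auto intro!: continuous_intros\<close>)
  have "(LINT x|lborel. (norm (u x *\<^sub>R ((p * norm x powr (p - 2)) *\<^sub>R x) + norm x powr p *\<^sub>R u' x))\<^sup>2)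
    \<le> (LINT x|lborel. 2 * (norm x powr (2 * p) * (norm (u' x))\<^sup>2) + 2 * p\<^sup>2 * (norm x powr (2 * p - 2) * (u x)\<^sup>2))"
  proof (rule integral_mono)
    show "integrable lborel (\<lambda>x. (norm (u x *\<^sub>R ((p * norm x powr (p - 2)) *\<^sub>R x) + norm x powr p *\<^sub>R u' x))\<^sup>2)"
      by (rule integrable_compact_support[OF C(1)])
         (use C u(2) in \<open>auto intro!: continuous_intros\<close>)
    show "integrable lborel (\<lambda>x. 2 * (norm x powr (2 * p) * (norm (u' x))\<^sup>2) + 2 * p\<^sup>2 * (norm x powr (2 * p - 2) * (u x)\<^sup>2))"
      using i1 i3 by simp
    fix x :: 'a
    let ?a = "u x *\<^sub>R ((p * norm x powr (p - 2)) *\<^sub>R x)" and ?b = "norm x powr p *\<^sub>R u' x"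
    show "(norm (?a + ?b))\<^sup>2 \<le> 2 * (norm x powr (2 * p) * (norm (u' x))\<^sup>2) + 2 * p\<^sup>2 * (norm x powr (2 * p - 2) * (u x)\<^sup>2)"
    proof (cases "x = 0")
      case True
      then show ?thesis using C u(2) by simp
    next
      case False
      have "(norm (?a + ?b))\<^sup>2 \<le> (norm ?a + norm ?b)\<^sup>2"
        by (intro power_mono norm_triangle_ineq) auto
      also have "\<dots> \<le> 2 * (norm ?a)\<^sup>2 + 2 * (norm ?b)\<^sup>2"
        using zero_le_power2[of "norm ?a - norm ?b"] by (simp add: power2_eq_square algebra_simps)
      also have "(norm ?b)\<^sup>2 = norm x powr (2 * p) * (norm (u' x))\<^sup>2"
        by (simp add: power_mult_distrib power2_eq_square flip: powr_add)
      also have "(norm ?a)\<^sup>2 = p\<^sup>2 * ((norm x powr (p - 2) * norm x powr (p - 2) * (norm x)\<^sup>2) * (u x)\<^sup>2)"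
        by (simp add: power2_eq_square mult_ac)
      also have "norm x powr (p - 2) * norm x powr (p - 2) * (norm x)\<^sup>2 = norm x powr (2 * p - 2)"
        using False by (simp add: norm_powr_mult_norm_square flip: powr_add)
      finally show ?thesis by simp
    qed
  qed
  also have "\<dots> = 2 * (LINT x|lborel. norm x powr (2 * p) * (norm (u' x))\<^sup>2)
      + 2 * p\<^sup>2 * (LINT x|lborel. norm x powr (2 * p - 2) * (u x)\<^sup>2)"
    using i1 i3 by simp
  finally show ?thesis .
qed

text \<open>The inequality \<delta> ln y \<le> y^\<delta> is applied to y = u |x|^\<beta> / (2l),
  and the power that appears is the superquadratic integrand of \<open>v\<close>. The conclusion
  supplies an integrable majorant \<open>G\<close> instead of integrating the logarithm itself, so
  that the boundary term can be added pointwise before any integrability of the logarithmic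
  integrand is shown.\<close>

lemma log_sobolev_weighted_origin:
  assumes "DIM('a::euclidean_space) \<ge> 3" "R > 0" and \<beta>: "\<beta> = (real DIM('a) - 2) / 2"
  obtains A B where "B > 0"
    "\<And>(u :: 'a \<Rightarrow> real) u' K s. \<lbrakk>C1_supp u u' K; 0 \<notin> K; K \<subseteq> cball 0 R; \<And>x. 0 \<le> u x;
        (LINT x|lborel. (u x)\<^sup>2) = 1; s > 0\<rbrakk> \<Longrightarrow>
       \<exists>G. integrable lborel G \<and> (\<forall>x. (u x)\<^sup>2 * ln (u x * norm x powr \<beta>) \<le> G x) \<and>
         (LINT x|lborel. G x) \<le> A + B * s\<^sup>2 * hardy_form u u' - real DIM('a) / 2 * ln s"
proof -
  define N where "N = real DIM('a)"
  define \<delta> where "\<delta> = 2 / N"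
  define q where "q = 2 powr \<delta>"
  \<comment> \<open>chosen so that \<open>v = |x|\<^sup>\<gamma> u\<close> satisfies \<open>v\<^sup>2\<^sup>+\<^sup>\<delta> = u\<^sup>2 (u |x|\<^sup>\<beta>)\<^sup>\<delta>\<close>\<close>
  define \<gamma> where "\<gamma> = \<delta> * \<beta> / (2 + \<delta>)"
  define \<omega> where "\<omega> = unit_ball_vol N"
  define CN where "CN = 4 * q / (1 - 1 / q)"
  have N: "N \<ge> 3" using assms by (simp add: N_def)
  have \<delta>: "\<delta> > 0" using N by (simp add: \<delta>_def)
  \<comment> \<open>Here dimension at least 3 enters through \<beta> > 0; positivity of \<gamma> is
    what makes the weighted Hardy inequality applicable with exponent 2 \<gamma>.\<close>
  have \<gamma>: "\<gamma> > 0" using N \<delta> \<beta> by (simp add: \<gamma>_def N_def)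
  have \<gamma>\<delta>: "\<gamma> * 2 + \<gamma> * \<delta> = \<beta> * \<delta>" 
  proof -
    have "\<gamma> * (2 + \<delta>) = \<delta> * \<beta>" using \<delta> by (simp add: \<gamma>_def)
    then show ?thesis by (simp add: algebra_simps)
  qed
  have \<omega>: "\<omega> > 0" using N by (simp add: \<omega>_def)
  have q: "q > 1" using \<delta> by (simp add: q_def)
  have CN: "CN > 0" using q by (simp add: CN_def)
  obtain CH where CH: "CH > 0"
    "\<And>(u :: 'a \<Rightarrow> real) u' K. \<lbrakk>C1_supp u u' K; 0 \<notin> K; K \<subseteq> cball 0 R\<rbrakk> \<Longrightarrow>
       (LINT x|lborel. norm x powr (2 * \<gamma>) * (norm (u' x))\<^sup>2) + (LINT x|lborel. norm x powr (2 * \<gamma> - 2) * (u x)\<^sup>2)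
         \<le> CH * hardy_form u u'"
    using weighted_hardy[of R "2 * \<gamma>", where 'a = 'a] assms \<gamma> by auto
  define c0 where "c0 = ln (2 * R powr \<gamma> / sqrt \<omega>)"
  define CB where "CB = CN * ((2 + 2 * \<gamma>\<^sup>2) * CH)"
  show ?thesis
  proof (rule that[of "1 / \<delta> * CB" "c0 + 1 / \<delta> * R powr (2 * \<gamma>)"])
    have "2 + 2 * \<gamma>\<^sup>2 > 0" by (intro add_pos_nonneg) auto
    then show "1 / \<delta> * CB > 0" using \<delta> CN CH by (simp add: CB_def)
    fix u :: "'a \<Rightarrow> real" and u' K and s :: real
    assume u: "C1_supp u u' K" "0 \<notin> K" "K \<subseteq> cball 0 R" and u0: "\<And>x. 0 \<le> u x"
      and u1: "(LINT x|lborel. (u x)\<^sup>2) = 1" and s: "s > 0"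
    note C = C1_suppD[OF u(1)]
    define v where "v x = u x * norm x powr \<gamma>" for x
    define v' where "v' x = u x *\<^sub>R ((\<gamma> * norm x powr (\<gamma> - 2)) *\<^sub>R x) + norm x powr \<gamma> *\<^sub>R u' x" for x
    have v: "C1_supp v v' K"
      using C1_supp_norm_powr_mult[OF u(1,2), of \<gamma>] by (simp add: v_def[abs_def] v'_def[abs_def])
    have v0: "0 \<le> v x" for x using u0 by (simp add: v_def)
    note Cv = C1_suppD[OF v]
    have iu: "integrable lborel (\<lambda>x. (u x)\<^sup>2)"
      by (rule integrable_compact_support[OF C(1)]) (use C in \<open>auto intro!: continuous_intros\<close>)
    have iv: "integrable lborel (\<lambda>x. (v x)\<^sup>2)"
      by (rule integrable_compact_support[OF Cv(1)]) (use Cv in \<open>auto intro!: continuous_intros\<close>)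
    have v2: "(LINT x|lborel. (v x)\<^sup>2) \<le> R powr (2 * \<gamma>)"
    proof -
      have "(LINT x|lborel. (v x)\<^sup>2) \<le> (LINT x|lborel. R powr (2 * \<gamma>) * (u x)\<^sup>2)"
      proof (rule integral_mono[OF iv])
        show "integrable lborel (\<lambda>x. R powr (2 * \<gamma>) * (u x)\<^sup>2)" using iu by simp
        fix x :: 'a
        show "(v x)\<^sup>2 \<le> R powr (2 * \<gamma>) * (u x)\<^sup>2"
        proof (cases "x \<in> K")
          case True
          have "(v x)\<^sup>2 = norm x powr (2 * \<gamma>) * (u x)\<^sup>2"
            by (simp add: v_def power_mult_distrib power2_eq_square flip: powr_add)
          also have "\<dots> \<le> R powr (2 * \<gamma>) * (u x)\<^sup>2"
            using True u(3) \<gamma> by (intro mult_right_mono powr_mono2) auto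
          finally show ?thesis .
        qed (simp add: Cv)
      qed
      then show ?thesis using u1 by simp
    qed
    have v'2: "(LINT x|lborel. (norm (v' x))\<^sup>2) \<le> (2 + 2 * \<gamma>\<^sup>2) * CH * hardy_form u u'"
    proof -
      let ?a = "LINT x|lborel. norm x powr (2 * \<gamma>) * (norm (u' x))\<^sup>2"
      let ?b = "LINT x|lborel. norm x powr (2 * \<gamma> - 2) * (u x)\<^sup>2"
      have ab: "?a \<ge> 0" "?b \<ge> 0" by simp_all
      have "(LINT x|lborel. (norm (v' x))\<^sup>2) \<le> 2 * ?a + 2 * \<gamma>\<^sup>2 * ?b"
        using integral_gradient_norm_powr_mult_le[OF u(1,2), of \<gamma>] by (simp add: v'_def)
      also have "\<dots> \<le> (2 + 2 * \<gamma>\<^sup>2) * (?a + ?b)"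
        using ab mult_nonneg_nonneg[OF zero_le_power2[of \<gamma>] ab(1)] by (simp add: algebra_simps)
      also have "\<dots> \<le> (2 + 2 * \<gamma>\<^sup>2) * (CH * hardy_form u u')"
        using CH(2)[OF u] by (intro mult_left_mono) auto
      finally show ?thesis by (simp add: mult.assoc)
    qed
    \<comment> \<open>This makes l^2 times the volume of the ball of radius \<open>s\<close> equal
      to \<open>R powr (2 * \<gamma>)\<close>, a bound for the integral of v^2. The power of
      \<open>s\<close> is the source of -(N/2) ln s.\<close>
    define l where "l = R powr \<gamma> / sqrt \<omega> * s powr (- N / 2)"
    have l: "l > 0" using assms \<omega> s by (simp add: l_def)
    have "l\<^sup>2 * measure lborel (ball (0::'a) s) = R powr (2 * \<gamma>)"
    proof -
      have "s powr (- N / 2) * s powr (- N / 2) * s ^ DIM('a) = 1"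
        using s by (simp add: N_def flip: powr_add powr_realpow)
      moreover have "R powr \<gamma> * R powr \<gamma> = R powr (2 * \<gamma>)"
        by (simp flip: powr_add)
      moreover have "sqrt \<omega> * sqrt \<omega> = \<omega>" using \<omega> by simp
      ultimately show ?thesis
        using s \<omega> by (simp add: content_ball l_def power2_eq_square mult_ac flip: \<omega>_def N_def)
    qed
    then have vl: "(LINT x|lborel. (v x)\<^sup>2) \<le> l\<^sup>2 * measure lborel (ball (0::'a) s)"
      using v2 by simp
    note W = superquadratic_integral_bound[OF v v0 s l vl \<delta>_def[unfolded N_def] q_def]
    define G where "G x = ln (2 * l) * (u x)\<^sup>2 + 1 / \<delta> * ((v x)\<^sup>2 * (v x / (2 * l)) powr \<delta>)" for x
    have "integrable lborel G"
      unfolding G_def[abs_def] using iu W(1) by simp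
    moreover have "(u x)\<^sup>2 * ln (u x * norm x powr \<beta>) \<le> G x" for x
    proof (cases "u x = 0")
      case False
      then have ux: "u x > 0" "norm x > 0"
        using u0[of x] C(4)[of x] u(2) by (auto simp: less_le)
      define y where "y = u x * norm x powr \<beta> / (2 * l)"
      have y: "y > 0" using ux l by (simp add: y_def)
      have "\<delta> * ln y \<le> y powr \<delta>"
        using ln_le_minus_one[of "y powr \<delta>"] y by (simp add: ln_powr)
      then have "ln y \<le> 1 / \<delta> * y powr \<delta>" using \<delta> by (simp add: field_simps)
      moreover have "ln (u x * norm x powr \<beta>) = ln (2 * l) + ln y"
        using ln_mult[of "2 * l" y] l y ux by (simp add: y_def)
      ultimately have "(u x)\<^sup>2 * ln (u x * norm x powr \<beta>) \<le> (u x)\<^sup>2 * (ln (2 * l) + 1 / \<delta> * y powr \<delta>)"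
        by (intro mult_left_mono) auto
      also have "(u x)\<^sup>2 * y powr \<delta> = (v x)\<^sup>2 * (v x / (2 * l)) powr \<delta>"
      proof -
        have "(norm x powr \<gamma>)\<^sup>2 * (norm x powr \<gamma>) powr \<delta> = (norm x powr \<beta>) powr \<delta>"
          using \<gamma>\<delta> ux by (simp add: powr_powr power2_eq_square mult_2_right flip: powr_add)
        then show ?thesis
          using ux l by (simp add: y_def v_def powr_mult powr_divide power_mult_distrib)
      qed
      then have "(u x)\<^sup>2 * (ln (2 * l) + 1 / \<delta> * y powr \<delta>) = G x"
        by (simp add: G_def distrib_left mult.left_commute mult.commute)
      finally show ?thesis .
    qed (simp add: G_def v_def)
    moreover have "(LINT x|lborel. G x) \<le> c0 + 1 / \<delta> * R powr (2 * \<gamma>) + 1 / \<delta> * CB * s\<^sup>2 * hardy_form u u' - real DIM('a) / 2 * ln s"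
    proof -
      have "(LINT x|lborel. G x) = ln (2 * l) + 1 / \<delta> * (LINT x|lborel. (v x)\<^sup>2 * (v x / (2 * l)) powr \<delta>)"
        unfolding G_def using iu W(1) u1 by simp
      also have "\<dots> \<le> ln (2 * l) + 1 / \<delta> * (R powr (2 * \<gamma>) + CN * s\<^sup>2 * ((2 + 2 * \<gamma>\<^sup>2) * CH * hardy_form u u'))"
      proof (intro add_left_mono mult_left_mono)
        have "CN * s\<^sup>2 * (LINT x|lborel. (norm (v' x))\<^sup>2) \<le> CN * s\<^sup>2 * ((2 + 2 * \<gamma>\<^sup>2) * CH * hardy_form u u')"
          using v'2 CN by (intro mult_left_mono) auto
        then show "(LINT x|lborel. (v x)\<^sup>2 * (v x / (2 * l)) powr \<delta>)
          \<le> R powr (2 * \<gamma>) + CN * s\<^sup>2 * ((2 + 2 * \<gamma>\<^sup>2) * CH * hardy_form u u')"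
          using W(2) v2 unfolding CN_def[symmetric] by linarith
      qed (use \<delta> in simp)
      also have "ln (2 * l) = c0 - real DIM('a) / 2 * ln s"
      proof -
        have "ln (2 * l) = ln (2 * R powr \<gamma> / sqrt \<omega> * s powr (- N / 2))"
          by (simp add: l_def mult.assoc)
        also have "\<dots> = c0 + ln (s powr (- N / 2))"
          unfolding c0_def using assms \<omega> s by (intro ln_mult_pos) auto
        finally show ?thesis using s by (simp add: ln_powr N_def)
      qed
      finally show ?thesis by (simp add: CB_def algebra_simps)
    qed
    ultimately show "\<exists>G. integrable lborel G \<and> (\<forall>x. (u x)\<^sup>2 * ln (u x * norm x powr \<beta>) \<le> G x) \<and>
         (LINT x|lborel. G x) \<le> c0 + 1 / \<delta> * R powr (2 * \<gamma>) + 1 / \<delta> * CB * s\<^sup>2 * hardy_form u u' - real DIM('a) / 2 * ln s"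
      by blast
  qed
qed

section \<open>The Hardy inequality at the boundary\<close>

lemma C_k_continuous_on: "C_k k f \<Longrightarrow> continuous_on S f"
  by (cases k) (auto intro: continuous_on_subset differentiable_imp_continuous_on
      simp: differentiable_on_def differentiable_at_withinI)

text \<open>\<open>C_k\<close> controls derivatives only in fixed directions, so the gradient is
  assembled from those along \<open>Basis\<close>, whose continuity is known.\<close>

lemma C_k_Suc_gradient:
  fixes f :: "'a::euclidean_space \<Rightarrow> real"
  assumes "C_k (Suc k) f"
  obtains f' where "\<And>x. GDERIV f x :> f' x" "continuous_on UNIV f'"
proof
  let ?f' = "\<lambda>x. \<Sum>b\<in>Basis. frechet_derivative f (at x) b *\<^sub>R b"
  show "continuous_on UNIV ?f'"
  proof (intro continuous_intros)
    fix b
    have "C_k k (\<lambda>x. frechet_derivative f (at x) b)" using assms by simp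
    then show "continuous_on UNIV (\<lambda>x. frechet_derivative f (at x) b)"
      by (rule C_k_continuous_on)
  qed
  show "GDERIV f x :> ?f' x" for x
  proof -
    have D: "(f has_derivative frechet_derivative f (at x)) (at x)"
      using assms frechet_derivative_works by auto
    interpret linear "frechet_derivative f (at x)"
      using D by (rule has_derivative_linear)
    have "frechet_derivative f (at x) h = h \<bullet> ?f' x" for h
    proof -
      have "frechet_derivative f (at x) (\<Sum>b\<in>Basis. (h \<bullet> b) *\<^sub>R b) = h \<bullet> ?f' x"
        by (simp only: sum scale inner_sum_right inner_scaleR_right real_scaleR_def mult.commute)
      then show ?thesis by (simp only: euclidean_representation)
    qed
    then have "frechet_derivative f (at x) = (\<lambda>h. h \<bullet> ?f' x)" by (rule ext)
    then show ?thesis using D unfolding gderiv_def by simp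
  qed
qed

text \<open>The squared positive part is continuously differentiable across 0; it will provide an
  explicit cutoff around a boundary point.\<close>

lemma DERIV_max_0_power2: "((\<lambda>t. (max 0 t)\<^sup>2) has_real_derivative 2 * max 0 t) (at (t::real))"
proof (cases t "0::real" rule: linorder_cases)
  case less
  have "((\<lambda>t. (max 0 t)\<^sup>2) has_real_derivative 0) (at t)"
    by (rule has_field_derivative_transform_within_open[where f = "\<lambda>_. 0" and S = "{..<0}"]) (use less in auto)
  then show ?thesis using less by simp
next
  case equal
  have "((\<lambda>h::real. (max 0 h)\<^sup>2 / h) \<longlongrightarrow> 0) (at 0)"
  proof (rule Lim_null_comparison)
    show "\<forall>\<^sub>F h in at 0. norm ((max 0 h)\<^sup>2 / h) \<le> \<bar>h::real\<bar>"
      by (rule always_eventually) (auto simp: max_def power2_eq_square)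
    show "((\<lambda>h::real. \<bar>h\<bar>) \<longlongrightarrow> 0) (at 0)"
      by (auto intro!: tendsto_eq_intros)
  qed
  then show ?thesis using equal by (simp add: DERIV_def)
next
  case greater
  have "((\<lambda>t. (max 0 t)\<^sup>2) has_real_derivative 2 * t) (at t)"
    by (rule has_field_derivative_transform_within_open[where f = "\<lambda>t. t\<^sup>2" and S = "{0<..}"])
       (use greater in \<open>auto intro!: derivative_eq_intros\<close>)
  then show ?thesis using greater by simp
qed

text \<open>Below, \<open>h\<close> is the height above the graph: it is comparable to the distance to the boundary, and its
  derivative in direction \<open>e\<close> is \<open>1\<close>, so that the one-dimensional Hardy inequality in that direction, applied
  to \<open>\<psi> u\<close> for a cutoff \<open>\<psi>\<close>, is an integration by parts against \<open>1 / h\<close>.\<close>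
lemma boundary_hardy_local:
  fixes \<Omega> :: "'a::euclidean_space set"
  assumes \<Omega>: "open \<Omega>" "\<Omega> \<subseteq> cball 0 R" "0 \<in> \<Omega>" and p: "p \<in> frontier \<Omega>"
    and r: "r > 0" "r \<le> norm p / 2" and R: "R > 0"
    and e: "norm e = 1" and \<gamma>: "C_k 2 \<gamma>"
    and graph: "\<Omega> \<inter> ball p r = {x \<in> ball p r. x \<bullet> e > \<gamma> (x - (x \<bullet> e) *\<^sub>R e)}"
  obtains C where "C > 0"
    "\<And>u u' K. \<lbrakk>C1_supp u u' K; 0 \<notin> K; K \<subseteq> \<Omega>\<rbrakk> \<Longrightarrow>
       (LINT x|lborel. indicator (ball p (r / 4)) x * ((u x)\<^sup>2 / (infdist x (frontier \<Omega>))\<^sup>2))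
         \<le> C * hardy_form u u'"
proof -
  obtain \<gamma>' where \<gamma>': "\<And>x. GDERIV \<gamma> x :> \<gamma>' x" "continuous_on UNIV \<gamma>'"
    using \<gamma> C_k_Suc_gradient[of 1 \<gamma>] by (auto simp: numeral_2_eq_2)
  define P where "P x = x - (x \<bullet> e) *\<^sub>R e" for x
  define h where "h x = x \<bullet> e - \<gamma> (P x)" for x
  define h' where "h' x = e - P (\<gamma>' (P x))" for x
  have ee: "e \<bullet> e = 1" using e by (simp add: norm_eq_1)
  have cP: "continuous_on S P" for S
    unfolding P_def by (intro continuous_intros)
  have h: "GDERIV h x :> h' x" for x
  proof -
    have dP: "(P has_derivative P) (at x)"
      unfolding P_def by (auto intro!: derivative_eq_intros)
    have "((\<lambda>x. \<gamma> (P x)) has_derivative (\<lambda>v. P v \<bullet> \<gamma>' (P x))) (at x)"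
      using has_derivative_compose[OF dP] \<gamma>'(1) unfolding gderiv_def by blast
    then have "(h has_derivative (\<lambda>v. v \<bullet> e - P v \<bullet> \<gamma>' (P x))) (at x)"
      unfolding h_def by (auto intro!: derivative_eq_intros)
    moreover have "P v \<bullet> \<gamma>' (P x) = v \<bullet> P (\<gamma>' (P x))" for v
      by (simp add: P_def inner_diff_left inner_diff_right inner_commute)
    ultimately show ?thesis
      by (simp add: gderiv_def h'_def inner_diff_right)
  qed
  \<comment> \<open>The correction \<open>P (\<gamma>' (P x))\<close> lies in the hyperplane
    orthogonal to \<open>e\<close>.\<close>
  have h'e: "h' x \<bullet> e = 1" for x
    by (simp add: h'_def P_def inner_diff_left ee)
  have ch': "continuous_on S h'" for S
    unfolding h'_def
    by (intro continuous_intros continuous_on_compose2[OF cP[of UNIV]] continuous_on_compose2[OF \<gamma>'(2)] cP) auto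
  have ch: "continuous_on S h" for S
    using h by (rule GDERIV_continuous_on)
  obtain L where L: "L > 0" "\<And>x. x \<in> cball p r \<Longrightarrow> norm (h' x) \<le> L"
  proof -
    have "bounded (h' ` cball p r)"
      by (intro compact_imp_bounded compact_continuous_image ch') auto
    then show ?thesis using that unfolding bounded_pos by auto
  qed
  have lip: "\<bar>h x - h y\<bar> \<le> L * norm (x - y)" if "x \<in> ball p r" "y \<in> ball p r" for x y
  proof -
    have "norm (h x - h y) \<le> L * norm (x - y)"
    proof (rule differentiable_bound[of "ball p r" h "\<lambda>x v. v \<bullet> h' x"])
      fix z assume z: "z \<in> ball p r"
      show "(h has_derivative (\<lambda>v. v \<bullet> h' z)) (at z within ball p r)"
        using h[of z] by (simp add: gderiv_def has_derivative_at_withinI)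
      show "onorm (\<lambda>v. v \<bullet> h' z) \<le> L"
      proof (rule onorm_le)
        fix v
        have "norm (v \<bullet> h' z) \<le> norm v * norm (h' z)"
          using Cauchy_Schwarz_ineq2 by simp
        also have "\<dots> \<le> norm v * L" using L(2)[of z] z by (intro mult_left_mono) auto
        finally show "norm (v \<bullet> h' z) \<le> L * norm v" by (simp add: mult.commute)
      qed
    qed (use that in auto)
    then show ?thesis by simp
  qed
  have graph': "x \<in> \<Omega> \<longleftrightarrow> h x > 0" if "x \<in> ball p r" for x
  proof -
    have "x \<in> \<Omega> \<inter> ball p r \<longleftrightarrow> x \<in> ball p r \<and> x \<bullet> e > \<gamma> (x - (x \<bullet> e) *\<^sub>R e)"
      by (subst graph) simp
    then show ?thesis using that by (simp add: h_def P_def)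
  qed
  let ?d = "\<lambda>x. infdist x (frontier \<Omega>)"
  \<comment> \<open>A nearest boundary point \<open>q\<close> of \<open>x\<close> still lies in
    \<open>ball p r\<close>, because \<open>p\<close> itself is a competitor at distance less than
    r/2. Since \<open>q\<close> is outside the open set \<Omega>, \<open>h q \<le> 0\<close>, and
    the Lipschitz bound for \<open>h\<close> gives the claim.\<close>
  have hd: "h x \<le> L * ?d x" if x: "x \<in> \<Omega>" "x \<in> ball p (r / 2)" for x
  proof -
    obtain q where q: "q \<in> frontier \<Omega>" "?d x = dist x q"
      using infdist_attains_inf[of "frontier \<Omega>" x] p by auto
    have "?d x \<le> dist x p" using p by (rule infdist_le)
    then have "dist x q < r / 2" using x q by (simp add: dist_commute)
    moreover have "dist p q \<le> dist p x + dist x q" by (rule dist_triangle)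
    ultimately have qr: "q \<in> ball p r" using x by simp
    have "q \<notin> \<Omega>" using q \<Omega>(1) by (auto simp: frontier_def interior_open)
    then have "h q \<le> 0" using graph'[OF qr] by auto
    moreover have "x \<in> ball p r" using x r by auto
    ultimately show ?thesis
      using lip[of x q] qr q by (simp add: dist_norm)
  qed
  have dpos: "?d x > 0" if "x \<in> \<Omega>" for x
  proof -
    have "x \<notin> frontier \<Omega>" using that \<Omega>(1) by (auto simp: frontier_def interior_open)
    then show ?thesis
      using infdist_pos_not_in_closed[of "frontier \<Omega>" x] p by auto
  qed
  \<comment> \<open>The cutoff \<psi> vanishes outside the ball of radius r/2 around
    \<open>p\<close>.\<close>
  define \<tau> where "\<tau> x = max 0 (r\<^sup>2 / 4 - (norm (x - p))\<^sup>2)" for x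
  define \<psi> where "\<psi> x = (\<tau> x)\<^sup>2" for x
  define \<psi>' where "\<psi>' x = (2 * \<tau> x) *\<^sub>R ((-2) *\<^sub>R (x - p))" for x
  have \<psi>: "GDERIV \<psi> x :> \<psi>' x" for x
  proof -
    have "GDERIV (\<lambda>x. r\<^sup>2 / 4 - (norm (x - p))\<^sup>2) x :> (-2) *\<^sub>R (x - p)"
      unfolding gderiv_def power2_norm_eq_inner
      by (auto intro!: derivative_eq_intros simp: inner_commute inner_diff_left inner_diff_right algebra_simps)
    from GDERIV_DERIV_compose[OF this DERIV_max_0_power2] show ?thesis
      by (simp add: \<psi>_def[abs_def] \<psi>'_def \<tau>_def)
  qed
  have c\<tau>: "continuous_on S \<tau>" for S
    unfolding \<tau>_def by (intro continuous_intros)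
  have c\<psi>': "continuous_on S \<psi>'" for S
    unfolding \<psi>'_def by (intro continuous_intros c\<tau>)
  have \<tau>0: "\<tau> x \<ge> 0" for x by (simp add: \<tau>_def)
  have \<tau>_le: "\<tau> x \<le> r\<^sup>2 / 4" for x unfolding \<tau>_def by (rule max.boundedI) auto
  have \<tau>_out: "\<tau> x = 0" if "x \<notin> ball p (r / 2)" for x
  proof -
    have "(r / 2)\<^sup>2 \<le> (norm (x - p))\<^sup>2"
      using that r by (intro power_mono) (auto simp: dist_norm norm_minus_commute)
    then show ?thesis by (simp add: \<tau>_def power_divide)
  qed
  \<comment> \<open>On the ball of radius r/4 one has \<tau> \<ge> r^2/4 - r^2/16 = 3 r^2/16, so
    \<open>m\<close> bounds \<psi> from below there.\<close>
  define m where "m = (3 * r\<^sup>2 / 16)\<^sup>2"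
  have m: "m > 0" using r by (simp add: m_def)
  have \<psi>_in: "m \<le> \<psi> x" if "x \<in> ball p (r / 4)" for x
  proof -
    have "(norm (x - p))\<^sup>2 \<le> (r / 4)\<^sup>2"
      using that by (intro power_mono) (auto simp: dist_norm norm_minus_commute)
    then have "3 * r\<^sup>2 / 16 \<le> \<tau> x"
      unfolding \<tau>_def by (intro max.coboundedI2) (simp add: power_divide)
    then show ?thesis unfolding m_def \<psi>_def by (rule power_mono) simp
  qed
  define b where "b = r\<^sup>2 / 4"
  \<comment> \<open>The two summands serve the terms with \<psi>' and with \<psi> in the gradient of
    \<open>w\<close>. Since r \<le> |p|/2, the cutoff lives where |x| is between |p|/2 and
    \<open>R\<close>, so the weights |x| and 1/|x| can be inserted at the cost of these
    constants.\<close>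
  define M where "M = 2 * (2 * b * r)\<^sup>2 * R + 2 * (b\<^sup>2)\<^sup>2 / (norm p / 2)"
  have p0: "norm p > 0" using r by linarith
  have M: "M > 0"
    using r p0 R by (auto simp: M_def b_def intro!: add_nonneg_pos)
  obtain CH where CH: "CH > 0"
    "\<And>(u :: 'a \<Rightarrow> real) u' K. \<lbrakk>C1_supp u u' K; 0 \<notin> K; K \<subseteq> cball 0 R\<rbrakk> \<Longrightarrow>
       (LINT x|lborel. norm x powr 1 * (norm (u' x))\<^sup>2) + (LINT x|lborel. norm x powr (1 - 2) * (u x)\<^sup>2)
         \<le> CH * hardy_form u u'"
    using weighted_hardy[of R 1, where 'a = 'a] R by auto
  show ?thesis
  proof (rule that[of "L\<^sup>2 / m\<^sup>2 * (4 * (M * CH))"])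
    show "L\<^sup>2 / m\<^sup>2 * (4 * (M * CH)) > 0" using L m M CH by simp
    fix u :: "'a \<Rightarrow> real" and u' K assume u: "C1_supp u u' K" "0 \<notin> K" "K \<subseteq> \<Omega>"
    note C = C1_suppD[OF u(1)]
    define w where "w x = u x * \<psi> x" for x
    define w' where "w' x = u x *\<^sub>R \<psi>' x + \<psi> x *\<^sub>R u' x" for x
    \<comment> \<open>Cutting down to the ball of radius r/2 places the compact set inside
      \<open>ball p r\<close>, where \<open>h\<close> is positive on \<Omega> and its reciprocal is
      continuously differentiable.\<close>
    define K' where "K' = K \<inter> cball p (r / 2)"
    have w: "C1_supp w w' K'"
    proof -
      have "C1_supp w w' K"
        using C1_supp_mult[OF u(1) open_UNIV subset_UNIV \<psi> c\<psi>'] by (simp add: w_def[abs_def] w'_def[abs_def])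
      then show ?thesis
        using \<tau>_out by (auto simp: C1_supp_def K'_def w_def \<psi>_def intro: compact_Int_closed)
    qed
    note Cw = C1_suppD[OF w]
    define U where "U = \<Omega> \<inter> ball p r"
    have U: "open U" "K' \<subseteq> U" using \<Omega>(1) u(3) r by (auto simp: U_def K'_def)
    have hU: "h x > 0" if "x \<in> U" for x using graph' that by (auto simp: U_def)
    have hK': "h x > 0" if "x \<in> K'" for x using hU U that by auto
    \<comment> \<open>By \<open>h'e\<close> the derivative of 1/h along \<open>e\<close> is exactly
      -1/h^2. The identity therefore equates the integral of (w/h)^2 with that of 2 (w/h) times the
      derivative of \<open>w\<close> along \<open>e\<close>.\<close>
    have IBP: "(LINT x|lborel. (w x)\<^sup>2 * ((- (inverse (h x))\<^sup>2 *\<^sub>R h' x) \<bullet> e) + inverse (h x) * (((2 * w x) *\<^sub>R w' x) \<bullet> e)) = 0"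
    proof (rule integration_by_parts[OF C1_supp_power2[OF w] U])
      show "GDERIV (\<lambda>x. inverse (h x)) x :> - (inverse (h x))\<^sup>2 *\<^sub>R h' x" if "x \<in> U" for x
        using h hU[OF that] by (intro GDERIV_inverse) auto
      show "continuous_on U (\<lambda>x. - (inverse (h x))\<^sup>2 *\<^sub>R h' x)"
        using hU by (intro continuous_intros ch ch') force
    qed
    have i1: "integrable lborel (\<lambda>x. (w x / h x)\<^sup>2)"
      by (rule integrable_compact_support[OF Cw(1)])
         (use Cw hK' in \<open>force intro!: continuous_intros ch\<close>)+
    have i2: "integrable lborel (\<lambda>x. 2 * (w x / h x) * (w' x \<bullet> e))"
      by (rule integrable_compact_support[OF Cw(1)])
         (use Cw hK' in \<open>force intro!: continuous_intros ch\<close>)+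
    have i3: "integrable lborel (\<lambda>x. (norm (w' x))\<^sup>2)"
      by (rule integrable_compact_support[OF Cw(1)])
         (use Cw in \<open>auto intro!: continuous_intros\<close>)
    have "(LINT x|lborel. (w x / h x)\<^sup>2) = (LINT x|lborel. 2 * (w x / h x) * (w' x \<bullet> e))"
    proof -
      have "(LINT x|lborel. 2 * (w x / h x) * (w' x \<bullet> e) - (w x / h x)\<^sup>2) = 0"
        using IBP by (simp add: h'e divide_inverse power_mult_distrib algebra_simps)
      then show ?thesis using i1 i2 by simp
    qed
    \<comment> \<open>Young's inequality is weighted so that half of the left side is absorbed,
      which gives the one-dimensional Hardy constant 4.\<close>
    also have "\<dots> \<le> (LINT x|lborel. 1 / 2 * (w x / h x)\<^sup>2 + 2 * (norm (w' x))\<^sup>2)"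
    proof (rule integral_mono[OF i2])
      show "integrable lborel (\<lambda>x. 1 / 2 * (w x / h x)\<^sup>2 + 2 * (norm (w' x))\<^sup>2)"
        using i1 i3 by simp
      fix x
      have "(w' x \<bullet> e)\<^sup>2 \<le> (norm (w' x))\<^sup>2"
        using power_mono[OF Cauchy_Schwarz_ineq2[of "w' x" e], of 2] e by simp
      moreover have "0 \<le> (w x / h x - 2 * (w' x \<bullet> e))\<^sup>2" by simp
      ultimately show "2 * (w x / h x) * (w' x \<bullet> e) \<le> 1 / 2 * (w x / h x)\<^sup>2 + 2 * (norm (w' x))\<^sup>2"
        unfolding power2_diff by (simp add: power_mult_distrib)
    qed
    also have "\<dots> = 1 / 2 * (LINT x|lborel. (w x / h x)\<^sup>2) + 2 * (LINT x|lborel. (norm (w' x))\<^sup>2)"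
      using i1 i3 by simp
    finally have wh: "(LINT x|lborel. (w x / h x)\<^sup>2) \<le> 4 * (LINT x|lborel. (norm (w' x))\<^sup>2)"
      by linarith
    have j1: "integrable lborel (\<lambda>x. norm x powr 1 * (norm (u' x))\<^sup>2)"
      by (rule integrable_compact_support[OF C(1)])
         (use C u(2) in \<open>auto intro!: continuous_intros\<close>)
    have j2: "integrable lborel (\<lambda>x. norm x powr (1 - 2) * (u x)\<^sup>2)"
      by (rule integrable_compact_support[OF C(1)])
         (use C u(2) in \<open>auto intro!: continuous_intros\<close>)
    have "(LINT x|lborel. (norm (w' x))\<^sup>2)
      \<le> (LINT x|lborel. M * (norm x powr 1 * (norm (u' x))\<^sup>2 + norm x powr (1 - 2) * (u x)\<^sup>2))"
    proof (rule integral_mono[OF i3])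
      show "integrable lborel (\<lambda>x. M * (norm x powr 1 * (norm (u' x))\<^sup>2 + norm x powr (1 - 2) * (u x)\<^sup>2))"
        using j1 j2 by simp
      fix x
      show "(norm (w' x))\<^sup>2 \<le> M * (norm x powr 1 * (norm (u' x))\<^sup>2 + norm x powr (1 - 2) * (u x)\<^sup>2)"
      proof (cases "x \<in> K'")
        case False
        then show ?thesis using Cw(6)[OF False] M by simp
      next
        case True
        then have xp: "norm (x - p) \<le> r / 2" and xK: "x \<in> K"
          by (auto simp: K'_def dist_norm norm_minus_commute)
        have "norm p \<le> norm x + norm (x - p)"
          by (metis norm_minus_commute norm_triangle_sub)
        then have x1: "norm p / 2 \<le> norm x" using xp r by linarith
        have x2: "norm x \<le> R" using xK u(3) \<Omega>(2) by auto
        have \<psi>b: "(\<psi> x)\<^sup>2 \<le> (b\<^sup>2)\<^sup>2"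
          unfolding \<psi>_def b_def using \<tau>0 \<tau>_le by (intro power_mono) auto
        have "norm (\<psi>' x) = 2 * \<tau> x * (2 * norm (x - p))"
          using \<tau>0 by (simp add: \<psi>'_def flip: scaleR_diff_right)
        also have "\<dots> \<le> 2 * b * r"
          using \<tau>0 \<tau>_le[of x] xp r by (intro mult_mono) (auto simp: b_def)
        finally have \<psi>'b: "(norm (\<psi>' x))\<^sup>2 \<le> (2 * b * r)\<^sup>2"
          by (intro power_mono) auto
        have "(norm (w' x))\<^sup>2 \<le> (norm (u x *\<^sub>R \<psi>' x) + norm (\<psi> x *\<^sub>R u' x))\<^sup>2"
          unfolding w'_def by (intro power_mono norm_triangle_ineq) auto
        also have "\<dots> \<le> 2 * (norm (u x *\<^sub>R \<psi>' x))\<^sup>2 + 2 * (norm (\<psi> x *\<^sub>R u' x))\<^sup>2"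
          using zero_le_power2[of "norm (u x *\<^sub>R \<psi>' x) - norm (\<psi> x *\<^sub>R u' x)"]
          by (simp add: power2_eq_square algebra_simps)
        also have "\<dots> = 2 * (norm (\<psi>' x))\<^sup>2 * (u x)\<^sup>2 + 2 * (\<psi> x)\<^sup>2 * (norm (u' x))\<^sup>2"
          by (simp add: power_mult_distrib)
        also have "\<dots> \<le> 2 * (2 * b * r)\<^sup>2 * (R * (norm x powr (1 - 2) * (u x)\<^sup>2)) + 2 * (b\<^sup>2)\<^sup>2 * (norm x powr 1 * (norm (u' x))\<^sup>2 / (norm p / 2))"
        proof (intro add_mono mult_mono)
          have "norm x > 0" using x1 p0 by linarith
          then have "1 \<le> R * norm x powr (1 - 2)"
            using x2 by (simp add: powr_minus_divide)
          from mult_right_mono[OF this, of "(u x)\<^sup>2"]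
          show "(u x)\<^sup>2 \<le> R * (norm x powr (1 - 2) * (u x)\<^sup>2)" by (simp add: mult.assoc)
          have "1 \<le> norm x powr 1 / (norm p / 2)"
            using x1 p0 by (simp add: field_simps)
          from mult_right_mono[OF this, of "(norm (u' x))\<^sup>2"]
          show "(norm (u' x))\<^sup>2 \<le> norm x powr 1 * (norm (u' x))\<^sup>2 / (norm p / 2)" by (simp add: mult_ac)
        qed (use \<psi>b \<psi>'b R in auto)
        also have "\<dots> = 2 * (2 * b * r)\<^sup>2 * R * (norm x powr (1 - 2) * (u x)\<^sup>2) + 2 * (b\<^sup>2)\<^sup>2 / (norm p / 2) * (norm x powr 1 * (norm (u' x))\<^sup>2)"
          by (simp add: mult.assoc)
        also have "\<dots> \<le> M * (norm x powr (1 - 2) * (u x)\<^sup>2) + M * (norm x powr 1 * (norm (u' x))\<^sup>2)"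
          using R p0 unfolding M_def by (intro add_mono mult_right_mono) auto
        finally show ?thesis by (simp add: distrib_left add.commute)
      qed
    qed
    also have "\<dots> = M * ((LINT x|lborel. norm x powr 1 * (norm (u' x))\<^sup>2) + (LINT x|lborel. norm x powr (1 - 2) * (u x)\<^sup>2))"
      using j1 j2 by simp
    also have "\<dots> \<le> M * (CH * hardy_form u u')"
      using CH(2)[OF u(1,2)] u(3) \<Omega>(2) M by (intro mult_left_mono) auto
    finally have w'b: "(LINT x|lborel. (norm (w' x))\<^sup>2) \<le> M * CH * hardy_form u u'" by simp
    have k: "integrable lborel (\<lambda>x. indicator (ball p (r / 4)) x * ((u x)\<^sup>2 / (?d x)\<^sup>2))"
    proof -
      have "integrable lborel (\<lambda>x. (u x)\<^sup>2 / (?d x)\<^sup>2)"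
      proof (rule integrable_compact_support[OF C(1)])
        have "?d x \<noteq> 0" if "x \<in> K" for x using dpos[of x] that u(3) by auto
        then show "continuous_on K (\<lambda>x. (u x)\<^sup>2 / (?d x)\<^sup>2)"
          by (intro continuous_intros continuous_on_infdist C) auto
      qed (simp add: C)
      then show ?thesis
        using integrable_mult_indicator[of "ball p (r / 4)" lborel "\<lambda>x. (u x)\<^sup>2 / (?d x)\<^sup>2"] by simp
    qed
    have "(LINT x|lborel. indicator (ball p (r / 4)) x * ((u x)\<^sup>2 / (?d x)\<^sup>2))
      \<le> (LINT x|lborel. L\<^sup>2 / m\<^sup>2 * (w x / h x)\<^sup>2)"
    proof (rule integral_mono[OF k])
      show "integrable lborel (\<lambda>x. L\<^sup>2 / m\<^sup>2 * (w x / h x)\<^sup>2)" using i1 by simp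
      fix x
      show "indicator (ball p (r / 4)) x * ((u x)\<^sup>2 / (?d x)\<^sup>2) \<le> L\<^sup>2 / m\<^sup>2 * (w x / h x)\<^sup>2"
      proof (cases "x \<in> ball p (r / 4) \<and> x \<in> K")
        case True
        then have x: "x \<in> ball p (r / 4)" "x \<in> \<Omega>" "x \<in> ball p (r / 2)" "x \<in> ball p r"
          using u(3) r by auto
        have hx: "h x > 0" using graph' x by auto
        have d: "?d x > 0" using dpos x by auto
        have "h x * m \<le> L * ?d x * \<psi> x"
          using hd[OF x(2,3)] \<psi>_in[OF x(1)] hx m by (intro mult_mono) auto
        then have "1 / ?d x \<le> L / m * (\<psi> x / h x)"
          using d hx m by (simp add: field_simps)
        then have "\<bar>u x\<bar> * (1 / ?d x) \<le> \<bar>u x\<bar> * (L / m * (\<psi> x / h x))"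
          by (rule mult_left_mono) simp
        then have "(\<bar>u x\<bar> * (1 / ?d x))\<^sup>2 \<le> (\<bar>u x\<bar> * (L / m * (\<psi> x / h x)))\<^sup>2"
          using d by (intro power_mono) auto
        then show ?thesis
          using x(1) by (simp add: w_def power_mult_distrib power_divide mult_ac)
      qed (use C in auto)
    qed
    also have "\<dots> = L\<^sup>2 / m\<^sup>2 * (LINT x|lborel. (w x / h x)\<^sup>2)" by simp
    also have "\<dots> \<le> L\<^sup>2 / m\<^sup>2 * (4 * (M * CH * hardy_form u u'))"
      using wh w'b by (intro mult_left_mono) auto
    finally show "(LINT x|lborel. indicator (ball p (r / 4)) x * ((u x)\<^sup>2 / (?d x)\<^sup>2))
      \<le> L\<^sup>2 / m\<^sup>2 * (4 * (M * CH)) * hardy_form u u'"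
      by (simp add: mult.assoc)
  qed
qed

text \<open>The compact frontier is covered by finitely many balls carrying the local inequality.
  The rest of the domain has positive distance from the frontier, so the integral there is
  controlled by the \<open>L^2\<close> norm, which the Hardy form dominates by the weighted
  inequality with exponent 2.\<close>

lemma boundary_hardy:
  fixes \<Omega> :: "'a::euclidean_space set"
  assumes dom: "smooth_bounded_domain \<Omega>" "0 \<in> \<Omega>" and R: "\<Omega> \<subseteq> cball 0 R" "R > 0"
  obtains C where "C > 0"
    "\<And>u u' K. \<lbrakk>C1_supp u u' K; 0 \<notin> K; K \<subseteq> \<Omega>\<rbrakk> \<Longrightarrow>
       (LINT x|lborel. (u x)\<^sup>2 / (infdist x (frontier \<Omega>))\<^sup>2) \<le> C * hardy_form u u'"
proof -
  have \<Omega>: "open \<Omega>" "bounded \<Omega>" "C2_boundary \<Omega>" "\<Omega> \<noteq> {}"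
    using dom by (auto simp: smooth_bounded_domain_def)
  let ?d = "\<lambda>x. infdist x (frontier \<Omega>)"
  have ne: "frontier \<Omega> \<noteq> {}"
    using \<Omega> frontier_not_empty[of \<Omega>] not_bounded_UNIV by blast
  have nf: "x \<notin> frontier \<Omega>" if "x \<in> \<Omega>" for x
    using that \<Omega>(1) by (auto simp: frontier_def interior_open)
  have dpos: "?d x > 0" if "x \<in> \<Omega>" for x
    using infdist_pos_not_in_closed[of "frontier \<Omega>" x] ne nf[OF that] by auto
  have "\<forall>p\<in>frontier \<Omega>. \<exists>\<rho> C. \<rho> > 0 \<and> C > 0 \<and> (\<forall>u u' K. C1_supp u u' K \<longrightarrow> 0 \<notin> K \<longrightarrow> K \<subseteq> \<Omega> \<longrightarrow>
     (LINT x|lborel. indicator (ball p \<rho>) x * ((u x)\<^sup>2 / (?d x)\<^sup>2)) \<le> C * hardy_form u u')"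
  proof
    fix p assume p: "p \<in> frontier \<Omega>"
    then obtain r e \<gamma> where g: "r > 0" "norm e = 1" "C_k 2 \<gamma>"
       "\<Omega> \<inter> ball p r = {x \<in> ball p r. x \<bullet> e > \<gamma> (x - (x \<bullet> e) *\<^sub>R e)}"
      using \<Omega>(3) unfolding C2_boundary_def by meson
    \<comment> \<open>Shrinking keeps the graph description valid and meets the requirement of the
      local lemma that the ball stay away from the origin.\<close>
    define r' where "r' = min r (norm p / 2)"
    have "p \<noteq> 0" using p nf dom by auto
    then have r': "r' > 0" "r' \<le> norm p / 2" using g by (auto simp: r'_def)
    have sub: "ball p r' \<subseteq> ball p r" by (auto simp: r'_def)
    have "\<Omega> \<inter> ball p r' = (\<Omega> \<inter> ball p r) \<inter> ball p r'" using sub by auto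
    also have "\<dots> = {x \<in> ball p r'. x \<bullet> e > \<gamma> (x - (x \<bullet> e) *\<^sub>R e)}"
      unfolding g(4) using sub by auto
    finally have g': "\<Omega> \<inter> ball p r' = {x \<in> ball p r'. x \<bullet> e > \<gamma> (x - (x \<bullet> e) *\<^sub>R e)}" .
    show "\<exists>\<rho> C. \<rho> > 0 \<and> C > 0 \<and> (\<forall>u u' K. C1_supp u u' K \<longrightarrow> 0 \<notin> K \<longrightarrow> K \<subseteq> \<Omega> \<longrightarrow>
     (LINT x|lborel. indicator (ball p \<rho>) x * ((u x)\<^sup>2 / (?d x)\<^sup>2)) \<le> C * hardy_form u u')"
    proof (rule boundary_hardy_local[OF \<Omega>(1) R(1) dom(2) p r' R(2) g(2,3) g'])
      fix C assume "C > 0" "\<And>u u' K. \<lbrakk>C1_supp u u' K; 0 \<notin> K; K \<subseteq> \<Omega>\<rbrakk> \<Longrightarrow>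
       (LINT x|lborel. indicator (ball p (r' / 4)) x * ((u x)\<^sup>2 / (?d x)\<^sup>2)) \<le> C * hardy_form u u'"
      then show ?thesis
        using r' by (intro exI[of _ "r' / 4"] exI[of _ C]) simp
    qed
  qed
  from bchoice[OF this] obtain \<rho> where "\<forall>p\<in>frontier \<Omega>. \<exists>C. \<rho> p > 0 \<and> C > 0 \<and>
    (\<forall>u u' K. C1_supp u u' K \<longrightarrow> 0 \<notin> K \<longrightarrow> K \<subseteq> \<Omega> \<longrightarrow>
     (LINT x|lborel. indicator (ball p (\<rho> p)) x * ((u x)\<^sup>2 / (?d x)\<^sup>2)) \<le> C * hardy_form u u')" ..
  from bchoice[OF this] obtain Cp where loc0: "\<forall>p\<in>frontier \<Omega>. \<rho> p > 0 \<and> Cp p > 0 \<and>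
    (\<forall>u u' K. C1_supp u u' K \<longrightarrow> 0 \<notin> K \<longrightarrow> K \<subseteq> \<Omega> \<longrightarrow>
     (LINT x|lborel. indicator (ball p (\<rho> p)) x * ((u x)\<^sup>2 / (?d x)\<^sup>2)) \<le> Cp p * hardy_form u u')" ..
  have \<rho>: "\<rho> p > 0" and Cp: "Cp p > 0" if "p \<in> frontier \<Omega>" for p
    using loc0 that by auto
  have loc: "(LINT x|lborel. indicator (ball p (\<rho> p)) x * ((u x)\<^sup>2 / (?d x)\<^sup>2)) \<le> Cp p * hardy_form u u'"
    if "p \<in> frontier \<Omega>" "C1_supp u u' K" "0 \<notin> K" "K \<subseteq> \<Omega>" for p u u' K
    using loc0 that by blast
  obtain F where F: "F \<subseteq> frontier \<Omega>" "finite F" "frontier \<Omega> \<subseteq> (\<Union>p\<in>F. ball p (\<rho> p))"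
  proof (rule compactE_image[of "frontier \<Omega>" "frontier \<Omega>" "\<lambda>p. ball p (\<rho> p)"])
    show "compact (frontier \<Omega>)" using \<Omega>(2) by (rule compact_frontier_bounded)
    show "frontier \<Omega> \<subseteq> (\<Union>p\<in>frontier \<Omega>. ball p (\<rho> p))" using \<rho> by force
  qed auto
  define S where "S = closure \<Omega> - (\<Union>p\<in>F. ball p (\<rho> p))"
  have S: "compact S" unfolding S_def
    using \<Omega>(2) by (intro compact_diff open_UN) (auto simp: compact_closure)
  \<comment> \<open>A point of the closure that avoids the cover is not on the frontier. With
    compactness this yields the positive minimum \<open>d0\<close> of the distance on
    \<open>S\<close>.\<close>
  have S\<Omega>: "S \<subseteq> \<Omega>"
    using F(3) \<Omega>(1) by (auto simp: S_def frontier_def interior_open)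
  obtain d0 where d0: "d0 > 0" "\<And>x. x \<in> S \<Longrightarrow> d0 \<le> ?d x"
  proof (cases "S = {}")
    case True
    then show ?thesis using that[of 1] by auto
  next
    case False
    have "continuous_on S ?d"
      by (intro continuous_on_infdist continuous_on_id)
    from continuous_attains_inf[OF S False this]
    obtain y where "y \<in> S" "\<And>x. x \<in> S \<Longrightarrow> ?d y \<le> ?d x"
      by blast
    then show ?thesis using that[of "?d y"] dpos S\<Omega> by auto
  qed
  obtain CH where CH: "CH > 0"
    "\<And>(u :: 'a \<Rightarrow> real) u' K. \<lbrakk>C1_supp u u' K; 0 \<notin> K; K \<subseteq> cball 0 R\<rbrakk> \<Longrightarrow>
       (LINT x|lborel. norm x powr 2 * (norm (u' x))\<^sup>2) + (LINT x|lborel. norm x powr (2 - 2) * (u x)\<^sup>2)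
         \<le> CH * hardy_form u u'"
    using weighted_hardy[of R 2, where 'a = 'a] R by auto
  show ?thesis
  proof (rule that[of "(\<Sum>p\<in>F. Cp p) + 1 / d0\<^sup>2 * CH"])
    have "(\<Sum>p\<in>F. Cp p) \<ge> 0" using Cp F(1) by (intro sum_nonneg less_imp_le) auto
    then show "(\<Sum>p\<in>F. Cp p) + 1 / d0\<^sup>2 * CH > 0"
      using d0 CH by (intro add_nonneg_pos mult_pos_pos) auto
    fix u :: "'a \<Rightarrow> real" and u' K assume u: "C1_supp u u' K" "0 \<notin> K" "K \<subseteq> \<Omega>"
    note C = C1_suppD[OF u(1)]
    define f where "f x = (u x)\<^sup>2 / (?d x)\<^sup>2" for x
    have i1: "integrable lborel f" unfolding f_def[abs_def]
    proof (rule integrable_compact_support[OF C(1)])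
      have "?d x \<noteq> 0" if "x \<in> K" for x using dpos[of x] that u(3) by auto
      then show "continuous_on K (\<lambda>x. (u x)\<^sup>2 / (?d x)\<^sup>2)"
        by (intro continuous_intros continuous_on_infdist C) auto
    qed (simp add: C)
    have i2: "integrable lborel (\<lambda>x. (u x)\<^sup>2)"
      by (rule integrable_compact_support[OF C(1)]) (use C in \<open>auto intro!: continuous_intros\<close>)
    have i3: "integrable lborel (\<lambda>x. indicator (ball p (\<rho> p)) x * f x)" for p
      using integrable_mult_indicator[OF _ i1, of "ball p (\<rho> p)"] by simp
    have f0: "f x \<ge> 0" for x by (simp add: f_def)
    have u2: "(LINT x|lborel. (u x)\<^sup>2) \<le> CH * hardy_form u u'"
    proof -
      \<comment> \<open>By convention \<open>0 powr 0 = 0\<close>, so at the origin the equality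
        relies on \<open>u 0 = 0\<close>.\<close>
      have "(LINT x|lborel. (u x)\<^sup>2) = (LINT x|lborel. norm x powr (2 - 2) * (u x)\<^sup>2)"
        using C(4) u(2) by (intro Bochner_Integration.integral_cong) auto
      also have "\<dots> \<le> CH * hardy_form u u'"
      proof -
        have "(LINT x|lborel. norm x powr 2 * (norm (u' x))\<^sup>2) \<ge> 0" by simp
        moreover have "K \<subseteq> cball 0 R" using u(3) R(1) by auto
        ultimately show ?thesis using CH(2)[OF u(1,2)] by linarith
      qed
      finally show ?thesis .
    qed
    have "(LINT x|lborel. f x) \<le> (LINT x|lborel. (\<Sum>p\<in>F. indicator (ball p (\<rho> p)) x * f x) + 1 / d0\<^sup>2 * (u x)\<^sup>2)"
    proof (rule integral_mono[OF i1])
      show "integrable lborel (\<lambda>x. (\<Sum>p\<in>F. indicator (ball p (\<rho> p)) x * f x) + 1 / d0\<^sup>2 * (u x)\<^sup>2)"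
        using i3 i2 by simp
      fix x
      have s0: "(\<Sum>p\<in>F. indicator (ball p (\<rho> p)) x * f x) \<ge> 0"
        using f0 by (intro sum_nonneg) auto
      show "f x \<le> (\<Sum>p\<in>F. indicator (ball p (\<rho> p)) x * f x) + 1 / d0\<^sup>2 * (u x)\<^sup>2"
      proof (cases "x \<in> K")
        case False
        then show ?thesis using C(4) by (simp add: f_def)
      next
        case True
        show ?thesis
        proof (cases "x \<in> S")
          case True
          then have "d0\<^sup>2 \<le> (?d x)\<^sup>2" using d0 by (intro power_mono) auto
          then have "f x \<le> (u x)\<^sup>2 / d0\<^sup>2"
            unfolding f_def using d0 by (intro divide_left_mono mult_pos_pos) (auto intro: less_le_trans)
          then show ?thesis using s0 by simp
        next
          case False
          with True u(3) closure_subset[of \<Omega>] obtain p where p: "p \<in> F" "x \<in> ball p (\<rho> p)"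
            by (auto simp: S_def)
          have "indicator (ball p (\<rho> p)) x * f x \<le> (\<Sum>p\<in>F. indicator (ball p (\<rho> p)) x * f x)"
            using f0 F(2) p by (intro member_le_sum) auto
          then show ?thesis using p by (simp add: add_increasing2)
        qed
      qed
    qed
    also have "\<dots> = (\<Sum>p\<in>F. LINT x|lborel. indicator (ball p (\<rho> p)) x * f x) + 1 / d0\<^sup>2 * (LINT x|lborel. (u x)\<^sup>2)"
      using i2 i3 by simp
    also have "\<dots> \<le> (\<Sum>p\<in>F. Cp p * hardy_form u u') + 1 / d0\<^sup>2 * (CH * hardy_form u u')"
      using loc[OF _ u] F(1) u2 unfolding f_def by (intro add_mono sum_mono mult_left_mono) auto
    finally show "(LINT x|lborel. (u x)\<^sup>2 / (?d x)\<^sup>2) \<le> ((\<Sum>p\<in>F. Cp p) + 1 / d0\<^sup>2 * CH) * hardy_form u u'"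
      by (simp add: f_def distrib_right mult.assoc flip: sum_distrib_right)
  qed
qed

section \<open>The logarithmic Sobolev inequality for the Hardy form\<close>

text \<open>The logarithm splits into the part with the weight at the origin and \<open>- ln\<close>
  of the boundary distance. Both are bounded at the same scale \<open>s\<close>, and their Hardy
  terms add up to (B + Cd/2) s^2 times the Hardy form.\<close>

lemma log_sobolev_normalized:
  fixes \<Omega> :: "'a::euclidean_space set"
  assumes N: "DIM('a) \<ge> 3" and dom: "smooth_bounded_domain \<Omega>" "0 \<in> \<Omega>"
  obtains K3 where "\<And>u u' K \<epsilon>. \<lbrakk>C1_supp u u' K; 0 \<notin> K; K \<subseteq> \<Omega>; \<And>x. 0 \<le> u x;
      (LINT x|lborel. (u x)\<^sup>2) = 1; \<epsilon> > 0\<rbrakk> \<Longrightarrow>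
    (LINT x|lborel. (u x)\<^sup>2 * ln (u x / (norm x powr ((2 - real DIM('a)) / 2) * infdist x (frontier \<Omega>))))
      \<le> \<epsilon> * hardy_form u u' + (K3 - (real DIM('a) + 2) / 4 * ln \<epsilon>)"
proof -
  have \<Omega>: "open \<Omega>" "bounded \<Omega>" "\<Omega> \<noteq> {}"
    using dom by (auto simp: smooth_bounded_domain_def)
  let ?d = "\<lambda>x. infdist x (frontier \<Omega>)"
  have dpos: "?d x > 0" if "x \<in> \<Omega>" for x
  proof -
    have "frontier \<Omega> \<noteq> {}"
      using \<Omega> frontier_not_empty[of \<Omega>] not_bounded_UNIV by blast
    moreover have "x \<notin> frontier \<Omega>" using that \<Omega>(1) by (auto simp: frontier_def interior_open)
    ultimately show ?thesis using infdist_pos_not_in_closed[of "frontier \<Omega>" x] by auto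
  qed
  obtain R where R: "R > 0" "\<Omega> \<subseteq> cball 0 R"
    using bounded_subset_ballD[OF \<Omega>(2), of 0] ball_subset_cball order_trans by metis
  define N where "N = real DIM('a)"
  define \<beta> where "\<beta> = (N - 2) / 2"
  obtain A B where B: "B > 0" and AB:
    "\<And>(u :: 'a \<Rightarrow> real) u' K s. \<lbrakk>C1_supp u u' K; 0 \<notin> K; K \<subseteq> cball 0 R; \<And>x. 0 \<le> u x;
        (LINT x|lborel. (u x)\<^sup>2) = 1; s > 0\<rbrakk> \<Longrightarrow>
       \<exists>G. integrable lborel G \<and> (\<forall>x. (u x)\<^sup>2 * ln (u x * norm x powr \<beta>) \<le> G x) \<and>
         (LINT x|lborel. G x) \<le> A + B * s\<^sup>2 * hardy_form u u' - N / 2 * ln s"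
    using log_sobolev_weighted_origin[OF N R(1) \<beta>_def[unfolded N_def]] unfolding N_def by metis
  obtain Cd where Cd: "Cd > 0" "\<And>u u' K. \<lbrakk>C1_supp u u' K; 0 \<notin> K; K \<subseteq> \<Omega>\<rbrakk> \<Longrightarrow>
       (LINT x|lborel. (u x)\<^sup>2 / (?d x)\<^sup>2) \<le> Cd * hardy_form u u'"
    by (rule boundary_hardy[OF dom R(2,1)]) blast
  \<comment> \<open>With s^2 = \<eta> \<epsilon> the total coefficient of the Hardy form becomes
    exactly \<epsilon>.\<close>
  define \<eta> where "\<eta> = 1 / (B + Cd / 2)"
  have \<eta>: "\<eta> > 0" "(B + Cd / 2) * \<eta> = 1" using B Cd by (simp_all add: \<eta>_def add_pos_pos less_imp_neq[symmetric])
  show ?thesis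
  proof (rule that[of "A - 1 / 2 - (N + 2) / 4 * ln \<eta>"])
    fix u :: "'a \<Rightarrow> real" and u' K and \<epsilon> :: real
    assume u: "C1_supp u u' K" "0 \<notin> K" "K \<subseteq> \<Omega>" and u0: "\<And>x. 0 \<le> u x"
      and u1: "(LINT x|lborel. (u x)\<^sup>2) = 1" and \<epsilon>: "\<epsilon> > 0"
    note C = C1_suppD[OF u(1)]
    have KR: "K \<subseteq> cball 0 R" using u(3) R by auto
    define s where "s = sqrt (\<eta> * \<epsilon>)"
    have s: "s > 0" "s\<^sup>2 = \<eta> * \<epsilon>" using \<eta> \<epsilon> by (simp_all add: s_def)
    have lns: "ln s = (ln \<eta> + ln \<epsilon>) / 2"
      using \<eta> \<epsilon> by (simp add: s_def ln_sqrt ln_mult)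
    obtain G where G: "integrable lborel G" "\<And>x. (u x)\<^sup>2 * ln (u x * norm x powr \<beta>) \<le> G x"
      "(LINT x|lborel. G x) \<le> A + B * s\<^sup>2 * hardy_form u u' - N / 2 * ln s"
      using AB[OF u(1,2) KR u0 u1 s(1)] by auto
    define w where "w x = norm x powr ((2 - real DIM('a)) / 2) * ?d x" for x
    define f where "f x = (u x)\<^sup>2 * ln (u x / w x)" for x
    define H where "H x = (u x)\<^sup>2 / (?d x)\<^sup>2" for x
    \<comment> \<open>The terms with \<open>H\<close> and \<open>1 / 2 + ln s\<close> come from ln t
      \<le> t - 1 at t = s^2/d^2. After integration against the normalized u^2 they contribute -1/2
      to the constant and a further -ln s.\<close>
    define g where "g x = G x + s\<^sup>2 / 2 * H x - (1 / 2 + ln s) * (u x)\<^sup>2" for x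
    have pos: "norm x > 0" "?d x > 0" "u x > 0" if "u x \<noteq> 0" for x
      using that C(4)[of x] u(2,3) dpos[of x] u0[of x] by (auto simp: less_le)
    have wpos: "w x > 0" if "u x \<noteq> 0" for x
      using pos[OF that] by (simp add: w_def)
    have fg: "f x \<le> g x" for x
    proof (cases "u x = 0")
      case True
      then show ?thesis using G(2)[of x] by (simp add: f_def g_def H_def)
    next
      case False
      note ps = pos[OF False]
      have "u x / w x = (u x * norm x powr \<beta>) / ?d x"
        using ps powr_minus_divide[of "norm x" \<beta>] by (simp add: w_def \<beta>_def N_def field_simps minus_divide_left)
      then have l1: "ln (u x / w x) = ln (u x * norm x powr \<beta>) - ln (?d x)"
        using ps by (simp add: ln_divide_pos)
      have "ln (s\<^sup>2 / (?d x)\<^sup>2) \<le> s\<^sup>2 / (?d x)\<^sup>2 - 1"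
        using ps s(1) by (intro ln_le_minus_one) auto
      moreover have "ln (s\<^sup>2 / (?d x)\<^sup>2) = 2 * ln s - 2 * ln (?d x)"
        using ps s(1) by (simp add: ln_divide_pos ln_realpow)
      ultimately have "- ln (?d x) \<le> s\<^sup>2 / 2 * (1 / (?d x)\<^sup>2) - (1 / 2 + ln s)"
        by simp
      then have "(u x)\<^sup>2 * (- ln (?d x)) \<le> (u x)\<^sup>2 * (s\<^sup>2 / 2 * (1 / (?d x)\<^sup>2) - (1 / 2 + ln s))"
        by (rule mult_left_mono) simp
      then show ?thesis
        using G(2)[of x] by (simp add: f_def g_def H_def l1 algebra_simps)
    qed
    \<comment> \<open>Monotonicity of the Bochner integral requires \<open>f\<close> to be
      integrable. The upper bound \<open>g\<close> alone does not give this; ln t \<le> t - 1 at t =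
      w/u supplies an integrable lower bound.\<close>
    have fl: "- (u x * w x) \<le> f x" for x
    proof (cases "u x = 0")
      case False
      note ps = pos[OF False] wpos[OF False]
      have "ln (w x / u x) \<le> w x / u x - 1" using ps by (intro ln_le_minus_one) auto
      moreover have "ln (w x / u x) = - ln (u x / w x)" using ps by (simp add: ln_divide_pos)
      ultimately have "- (w x / u x) \<le> ln (u x / w x)" by linarith
      then have "(u x)\<^sup>2 * (- (w x / u x)) \<le> f x" unfolding f_def by (rule mult_left_mono) simp
      then show ?thesis using ps by (simp add: power2_eq_square)
    qed (simp add: f_def)
    have i1: "integrable lborel (\<lambda>x. (u x)\<^sup>2)"
      by (rule integrable_compact_support[OF C(1)]) (use C in \<open>auto intro!: continuous_intros\<close>)
    have i2: "integrable lborel H"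
      unfolding H_def[abs_def]
    proof (rule integrable_compact_support[OF C(1)])
      have "?d x \<noteq> 0" if "x \<in> K" for x using dpos[of x] that u(3) by auto
      then show "continuous_on K (\<lambda>x. (u x)\<^sup>2 / (?d x)\<^sup>2)"
        by (intro continuous_intros continuous_on_infdist C) auto
    qed (simp add: C)
    have i3: "integrable lborel (\<lambda>x. u x * w x)" unfolding w_def
      by (rule integrable_compact_support[OF C(1)])
         (use C u(2) in \<open>auto intro!: continuous_intros continuous_on_infdist\<close>)
    have ig: "integrable lborel g" unfolding g_def[abs_def] using G(1) i1 i2 by simp
    have "f \<in> borel_measurable borel"
    proof -
      have [measurable]: "u \<in> borel_measurable borel" "?d \<in> borel_measurable borel"
        using C(5) by (auto intro!: borel_measurable_continuous_onI continuous_on_infdist)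
      show ?thesis unfolding f_def[abs_def] w_def by measurable
    qed
    then have "integrable lborel f"
    proof (intro Bochner_Integration.integrable_bound[OF Bochner_Integration.integrable_add[OF integrable_norm[OF ig] i3]] AE_I2)
      fix x
      have "0 \<le> u x * w x" using u0 by (simp add: w_def infdist_nonneg)
      then show "norm (f x) \<le> norm (norm (g x) + u x * w x)" using fg[of x] fl[of x] by auto
    qed simp
    then have "(LINT x|lborel. f x) \<le> (LINT x|lborel. g x)"
      using ig fg by (intro integral_mono) auto
    also have "\<dots> = (LINT x|lborel. G x) + s\<^sup>2 / 2 * (LINT x|lborel. H x) - (1 / 2 + ln s)"
      unfolding g_def using G(1) i1 i2 u1 by simp
    also have "\<dots> \<le> (A + B * s\<^sup>2 * hardy_form u u' - N / 2 * ln s) + s\<^sup>2 / 2 * (Cd * hardy_form u u') - (1 / 2 + ln s)"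
      using G(3) Cd(2)[OF u] unfolding H_def by (intro diff_right_mono add_mono mult_left_mono) auto
    also have "\<dots> = ((B + Cd / 2) * \<eta>) * (\<epsilon> * hardy_form u u') + (A - 1 / 2 - (N + 2) / 2 * ln s)"
      by (simp add: s(2) field_simps)
    \<comment> \<open>As ln s is half of ln \<eta> + ln \<epsilon>, the factor (N+2)/2 turns into
      (N+2)/4, and the part with \<eta> joins the constant.\<close>
    also have "\<dots> = \<epsilon> * hardy_form u u' + (A - 1 / 2 - (N + 2) / 4 * ln \<eta> - (N + 2) / 4 * ln \<epsilon>)"
      unfolding \<eta>(2) lns by (simp add: field_simps)
    finally show "(LINT x|lborel. (u x)\<^sup>2 * ln (u x / (norm x powr ((2 - real DIM('a)) / 2) * ?d x)))
      \<le> \<epsilon> * hardy_form u u' + (A - 1 / 2 - (N + 2) / 4 * ln \<eta> - (real DIM('a) + 2) / 4 * ln \<epsilon>)"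
      by (simp add: f_def w_def N_def)
  qed
qed

section \<open>Passage from test functions to normalized C1 functions\<close>

lemma test_function_C1_supp:
  assumes "test_function u U"
  obtains u' K where "C1_supp u u' K" "K \<subseteq> U" "\<And>x. grad u x = u' x"
proof -
  have "C_k (Suc 0) u" using assms unfolding test_function_def by blast
  then obtain u' where u': "\<And>x. GDERIV u x :> u' x" "continuous_on UNIV u'"
    using C_k_Suc_gradient by metis
  show ?thesis
  proof (rule that[of u' "closure {x. u x \<noteq> 0}"])
    show "C1_supp u u' (closure {x. u x \<noteq> 0})"
      using assms u' closure_subset[of "{x. u x \<noteq> 0}"] by (auto simp: C1_supp_def test_function_def)
  qed (use assms u' in \<open>auto simp: test_function_def intro: grad_eqI\<close>)
qed

text \<open>If the integral were 0, the set where \<open>u\<close> is nonzero would be null; by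
  continuity it is open, and a nonempty open set is never null. This permits division by the
  \<open>L^2\<close> norm.\<close>

lemma C1_supp_integral_power2_pos:
  assumes u: "C1_supp u u' K" and "u a \<noteq> 0"
  shows "(LINT x|lborel. (u x)\<^sup>2) > 0"
proof (rule ccontr)
  note C = C1_suppD[OF u]
  have i: "integrable lborel (\<lambda>x. (u x)\<^sup>2)"
    by (rule integrable_compact_support[OF C(1)]) (use C in \<open>auto intro!: continuous_intros\<close>)
  assume "\<not> (LINT x|lborel. (u x)\<^sup>2) > 0"
  moreover have "(LINT x|lborel. (u x)\<^sup>2) \<ge> 0" by simp
  ultimately have "(LINT x|lborel. (u x)\<^sup>2) = 0" by linarith
  then have "AE x in lborel. (u x)\<^sup>2 = 0"
    using integral_nonneg_eq_0_iff_AE[OF i] by simp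
  then have "AE x in lborel. x \<notin> {x. u x \<noteq> 0}" by simp
  moreover have op: "open {x. u x \<noteq> 0}"
    using open_Collect_neq[OF C(5) continuous_on_const] .
  ultimately have "{x. u x \<noteq> 0} \<in> null_sets lborel"
    by (subst AE_iff_null_sets) auto
  then have "negligible {x. u x \<noteq> 0}"
    by (simp add: negligible_iff_null_sets null_sets_completionI)
  then show False using open_not_negligible[OF op] assms(2) by auto
qed

lemma set_integral_eq_integral:
  fixes f :: "'a::euclidean_space \<Rightarrow> real"
  assumes "\<And>x. x \<notin> S \<Longrightarrow> f x = 0"
  shows "(LINT x:S|lborel. f x) = (LINT x|lborel. f x)"
  unfolding set_lebesgue_integral_def
  by (intro Bochner_Integration.integral_cong) (auto simp: indicator_def assms)

theorem theorem3p3: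
  fixes \<Omega> :: "(real ^ 'n) set"
  assumes "CARD('n) \<ge> 3"
    and "smooth_bounded_domain \<Omega>"
    and "0 \<in> \<Omega>"
  shows "\<exists>K3::real. K3 > 0 \<and>
    (\<forall>u :: real ^ 'n \<Rightarrow> real. \<forall>\<epsilon>::real.
       test_function u (\<Omega> - {0}) \<longrightarrow> (\<forall>x. u x \<ge> 0) \<longrightarrow> (\<exists>x. u x \<noteq> 0) \<longrightarrow> \<epsilon> > 0 \<longrightarrow>
       (LINT x:\<Omega>|lborel.
          (if u x = 0 then 0
           else (u x)\<^sup>2 * ln (u x / (L2_norm_on \<Omega> u * norm x powr ((2 - real CARD('n)) / 2)
                                     * infdist x (frontier \<Omega>)))))
       \<le> \<epsilon> * (LINT x:\<Omega>|lborel.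
                (norm (grad u x))\<^sup>2 - (real CARD('n) - 2)\<^sup>2 / (4 * (norm x)\<^sup>2) * (u x)\<^sup>2)
         + (K3 - (real CARD('n) + 2) / 4 * ln \<epsilon>) * (L2_norm_on \<Omega> u)\<^sup>2)"
proof -
  have "DIM(real ^ 'n) \<ge> 3" using assms(1) by simp
  from log_sobolev_normalized[OF this assms(2,3)] obtain k where k:
    "\<And>(u :: real ^ 'n \<Rightarrow> real) u' K \<epsilon>. \<lbrakk>C1_supp u u' K; 0 \<notin> K; K \<subseteq> \<Omega>; \<And>x. 0 \<le> u x;
      (LINT x|lborel. (u x)\<^sup>2) = 1; \<epsilon> > 0\<rbrakk> \<Longrightarrow>
    (LINT x|lborel. (u x)\<^sup>2 * ln (u x / (norm x powr ((2 - real CARD('n)) / 2) * infdist x (frontier \<Omega>))))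
      \<le> \<epsilon> * hardy_form u u' + (k - (real CARD('n) + 2) / 4 * ln \<epsilon>)"
    by auto
  show ?thesis
  \<comment> \<open>The constant \<open>k\<close> from the normalized inequality carries no sign;
    enlarging it to at least 1 gives a positive constant and only weakens the bound.\<close>
  proof (intro exI[of _ "max 1 k"] conjI allI impI)
    show "max 1 k > 0" by simp
    fix u :: "real ^ 'n \<Rightarrow> real" and \<epsilon> :: real
    assume tf: "test_function u (\<Omega> - {0})" and u0: "\<forall>x. 0 \<le> u x" and "\<exists>x. u x \<noteq> 0" and \<epsilon>: "\<epsilon> > 0"
    obtain u' K where u: "C1_supp u u' K" "K \<subseteq> \<Omega> - {0}" and gr: "\<And>x. grad u x = u' x"
      using test_function_C1_supp[OF tf] by metis
    note C = C1_suppD[OF u(1)]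
    have off: "u x = 0" "u' x = 0" if "x \<notin> \<Omega>" for x using that C(4,6) u(2) by auto
    define M where "M = L2_norm_on \<Omega> u"
    have M2: "M\<^sup>2 = (LINT x|lborel. (u x)\<^sup>2)"
      unfolding M_def L2_norm_on_def by (subst set_integral_eq_integral) (use off in auto)
    moreover have "(LINT x|lborel. (u x)\<^sup>2) > 0"
      using \<open>\<exists>x. u x \<noteq> 0\<close> C1_supp_integral_power2_pos[OF u(1)] by blast
    moreover have "M \<ge> 0"
      unfolding M_def L2_norm_on_def set_lebesgue_integral_def by simp
    ultimately have M: "M > 0" by (metis less_le power_zero_numeral)
    \<comment> \<open>Dividing by the norm places \<open>M\<close> inside the logarithm, and both
      sides of the inequality scale by \<open>M^2\<close>.\<close>
    define v where "v x = u x * (1 / M)" for x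
    define v' where "v' x = (1 / M) *\<^sub>R u' x" for x
    have v: "C1_supp v v' K"
      using C1_supp_mult[OF u(1) open_UNIV subset_UNIV GDERIV_const[of "1 / M"] continuous_on_const]
      by (simp add: v_def[abs_def] v'_def[abs_def])
    have v0: "0 \<le> v x" for x using u0 M by (simp add: v_def)
    have v1: "(LINT x|lborel. (v x)\<^sup>2) = 1"
      using M by (simp add: v_def power_mult_distrib power_divide flip: M2)
    have hf: "hardy_form u u' = M\<^sup>2 * hardy_form v v'"
      unfolding hardy_form_def v_def v'_def using M
      by (subst integral_mult_right_zero[symmetric], intro Bochner_Integration.integral_cong)
         (simp_all add: power_mult_distrib field_simps)
    let ?w = "\<lambda>x. norm x powr ((2 - real CARD('n)) / 2) * infdist x (frontier \<Omega>)"
    \<comment> \<open>The case distinction is absorbed because the factor \<open>(v x)^2\<close>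
      vanishes where \<open>u\<close> does, whatever value \<open>ln\<close> takes there.\<close>
    have "(LINT x:\<Omega>|lborel. (if u x = 0 then 0
           else (u x)\<^sup>2 * ln (u x / (M * norm x powr ((2 - real CARD('n)) / 2) * infdist x (frontier \<Omega>)))))
       = (LINT x|lborel. M\<^sup>2 * ((v x)\<^sup>2 * ln (v x / ?w x)))"
      using off M
      by (subst set_integral_eq_integral, simp, intro Bochner_Integration.integral_cong)
         (auto simp: v_def power_divide mult.assoc)
    also have "\<dots> = M\<^sup>2 * (LINT x|lborel. (v x)\<^sup>2 * ln (v x / ?w x))"
      by simp
    also have "\<dots> \<le> M\<^sup>2 * (\<epsilon> * hardy_form v v' + (k - (real CARD('n) + 2) / 4 * ln \<epsilon>))"
      using u(2) v0 v1 \<epsilon> by (intro mult_left_mono k[OF v]) auto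
    also have "\<dots> \<le> M\<^sup>2 * (\<epsilon> * hardy_form v v' + (max 1 k - (real CARD('n) + 2) / 4 * ln \<epsilon>))"
      by (intro mult_left_mono) auto
    also have "\<dots> = \<epsilon> * hardy_form u u' + (max 1 k - (real CARD('n) + 2) / 4 * ln \<epsilon>) * M\<^sup>2"
      by (simp add: hf algebra_simps)
    also have "hardy_form u u' = (LINT x:\<Omega>|lborel. (norm (grad u x))\<^sup>2 - (real CARD('n) - 2)\<^sup>2 / (4 * (norm x)\<^sup>2) * (u x)\<^sup>2)"
      unfolding hardy_form_def gr by (subst set_integral_eq_integral) (use off in auto)
    finally show "(LINT x:\<Omega>|lborel.
          (if u x = 0 then 0
           else (u x)\<^sup>2 * ln (u x / (L2_norm_on \<Omega> u * norm x powr ((2 - real CARD('n)) / 2)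
                                     * infdist x (frontier \<Omega>)))))
       \<le> \<epsilon> * (LINT x:\<Omega>|lborel.
                (norm (grad u x))\<^sup>2 - (real CARD('n) - 2)\<^sup>2 / (4 * (norm x)\<^sup>2) * (u x)\<^sup>2)
         + (max 1 k - (real CARD('n) + 2) / 4 * ln \<epsilon>) * (L2_norm_on \<Omega> u)\<^sup>2"
      by (simp only: M_def)
  qed
qed

end
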